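(* Let $A\in\mathrm{GL}_n(\mathbb{C})$ and let $(f_t)_{t\in\mathbb{C}^k}\subset\hat G_A$ be a polynomial family $$f_t(z)=Az+\sum_{0\le|i|\le d_0}t^i f_i(z)$$ where $i\in\mathbb{N}^k$ is a multi-index and the $f_i$ are ($n$-tuples of) formal power series in $z\in\mathbb{C}^n$ with no terms of order less than $2$. Then there is a polynomial family of formal linearizations $(h_{t,s})_{(t,s)\in\mathbb{C}^k\times\mathbb{C}^{\delta(A)}}\subset\hat G_0$ with $$h_{t,s}=\psi_{\infty,A,f_t}(s)$$ for suitable choices of the universal linearization isomorphisms $\psi_{\infty,A,f_t}:\mathbb{C}^{\delta(A)}\to\hat G_0(f_t)$. More precisely, the coefficients of the monomials of order $m$ of $h_{t,s}$ are polynomials in $t$ of degree at most $d_0m$ (and affine in $s$).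
   Context: $\hat G$ is the group, under composition, of formal diffeomorphisms of $(\mathbb{C}^n,0)$ fixing $0$ ($n$-tuples of formal power series without constant term and with invertible linear part); $\hat G_0\subset\hat G$ is the subgroup of elements $h$ with $D_0h=I$; $\pi_m$ is truncation to the $m$-jet; $\pi_m(\hat G_0)$ is identified with $\mathbb{C}^{d(m)-n^2}$ by the coefficients of monomials of order between $2$ and $m$, where $d(m)$ is the number of coefficients of an $m$-jet of an element of $\hat G$. The matrix $A$ is assumed in Jordan normal form. $\hat G_A=\{h^{-1}\circ A\circ h: h\in\hat G_0\}$ is the set of formal diffeomorphisms formally conjugated to $A$. For $f\in\hat G_A$, $\hat G_0(f)=\{h\in\hat G_0:h\circ f\circ h^{-1}=A\}$ is the set of formal linearizations of $f$. Let $\mathrm{Cent}(A)=\{k\in\hat G_0: k\circ A=A\circ k\}$. For each $m$, $\pi_m(\mathrm{Cent}(A))$ is a linear subspace of $\mathbb{C}^{d(m)-n^2}$, of dimension denoted $\delta(A,m)$, and $\delta(A)=\lim_m\delta(A,m)\in\mathbb{N}\cup\{+\infty\}$; if $\delta(A)=+\infty$, $\mathbb{C}^{\delta(A)}$ is the space of all complex sequences. Choosing bases compatible with truncation gives a linear isomorphism $\psi_{\infty,A}:\mathbb{C}^{\delta(A)}\to\mathrm{Cent}(A)$ (whose $m$-jet depends only on, and is parametrized bijectively by, the first $\delta(A,m)$ coordinates). For $f\in\hat G_A$ and a chosen $h_0\in\hat G_0(f)$, the universal linearization isomorphism is $\psi_{\infty,A,f}(s)=\psi_{\infty,A}(s)\circ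 h_0$, which is an affine bijection of $\mathbb{C}^{\delta(A)}$ onto $\hat G_0(f)$; it depends on the choice of the bases and of $h_0$. "Polynomial family" means that each power series coefficient of $h_{t,s}$ is a polynomial in $t$ and in finitely many coordinates of $s$. *)

theory Defs
  imports "HOL-Analysis.Analysis" "HOL-Algebra.Group" "HOL-Library.Multiset"
begin

section \<open>Formal power series in several variables\<close>

text \<open>
  A multi-index is a function \<open>'n \<Rightarrow> nat\<close> on the finite type \<open>'n\<close> indexing the variables.
\<close>

definition mdeg :: "('n::finite \<Rightarrow> nat) \<Rightarrow> nat"
  where "mdeg \<alpha> = (\<Sum>i\<in>UNIV. \<alpha> i)"

lemma finite_mdeg_le: "finite {\<alpha> :: 'n::finite \<Rightarrow> nat. mdeg \<alpha> \<le> d}"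
proof -
  have "\<alpha> j \<le> d" if "mdeg \<alpha> \<le> d" for \<alpha> :: "'n \<Rightarrow> nat" and j
  proof -
    have "\<alpha> j \<le> mdeg \<alpha>"
      unfolding mdeg_def by (rule member_le_sum) simp_all
    with that show ?thesis by simp
  qed
  then have "{\<alpha> :: 'n \<Rightarrow> nat. mdeg \<alpha> \<le> d} \<subseteq> PiE UNIV (\<lambda>_. {..d})"
    by auto
  moreover have "finite (PiE (UNIV :: 'n set) (\<lambda>_. {..d}))"
    by (intro finite_PiE) simp_all
  ultimately show ?thesis
    by (rule finite_subset)
qed

definition unit_index :: "'n \<Rightarrow> 'n \<Rightarrow> nat"
  where "unit_index j = (\<lambda>i. if i = j then 1 else 0)"

definition index_splits :: "('n \<Rightarrow> nat) \<Rightarrow> (('n \<Rightarrow> nat) \<times> ('n \<Rightarrow> nat)) set"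
  where "index_splits \<alpha> = {(\<beta>, \<gamma>). \<forall>i. \<beta> i + \<gamma> i = \<alpha> i}"

lemma finite_index_splits: "finite (index_splits (\<alpha> :: 'n::finite \<Rightarrow> nat))"
proof -
  have "finite (PiE UNIV (\<lambda>i. {..\<alpha> i}))"
    by (intro finite_PiE) simp_all
  moreover have "index_splits \<alpha> \<subseteq> PiE UNIV (\<lambda>i. {..\<alpha> i}) \<times> PiE UNIV (\<lambda>i. {..\<alpha> i})"
    by (auto simp: index_splits_def PiE_def Pi_def) (metis le_add1, metis le_add2)
  ultimately show ?thesis
    by (meson finite_SigmaI finite_subset)
qed

typedef 'n mfps = "UNIV :: (('n \<Rightarrow> nat) \<Rightarrow> complex) set"
  morphisms mcoeff Abs_mfps by simp

lemma mcoeff_Abs_mfps [simp]: "mcoeff (Abs_mfps f) \<alpha> = f \<alpha>"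
  by (simp add: Abs_mfps_inverse)

lemma mfps_eqI: "(\<And>\<alpha>. mcoeff f \<alpha> = mcoeff g \<alpha>) \<Longrightarrow> f = g"
  by (metis mcoeff_inject ext)

instantiation mfps :: (finite) comm_ring_1
begin

definition zero_mfps :: "'a mfps"
  where "zero_mfps = Abs_mfps (\<lambda>_. 0)"

definition one_mfps :: "'a mfps"
  where "one_mfps = Abs_mfps (\<lambda>\<alpha>. if \<alpha> = (\<lambda>_. 0) then 1 else 0)"

definition plus_mfps :: "'a mfps \<Rightarrow> 'a mfps \<Rightarrow> 'a mfps"
  where "f + g = Abs_mfps (\<lambda>\<alpha>. mcoeff f \<alpha> + mcoeff g \<alpha>)"

definition minus_mfps :: "'a mfps \<Rightarrow> 'a mfps \<Rightarrow> 'a mfps"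
  where "f - g = Abs_mfps (\<lambda>\<alpha>. mcoeff f \<alpha> - mcoeff g \<alpha>)"

definition uminus_mfps :: "'a mfps \<Rightarrow> 'a mfps"
  where "- f = Abs_mfps (\<lambda>\<alpha>. - mcoeff f \<alpha>)"

definition times_mfps :: "'a mfps \<Rightarrow> 'a mfps \<Rightarrow> 'a mfps"
  where "f * g = Abs_mfps (\<lambda>\<alpha>. \<Sum>(\<beta>, \<gamma>)\<in>index_splits \<alpha>. mcoeff f \<beta> * mcoeff g \<gamma>)"

instance
proof
  fix a b c :: "'a mfps"
  show "a * b * c = a * (b * c)"
  proof (rule mfps_eqI)
    fix \<alpha> :: "'a \<Rightarrow> nat"
    have "mcoeff (a * b * c) \<alpha> =
        (\<Sum>p\<in>index_splits \<alpha>. \<Sum>q\<in>index_splits (fst p).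
           mcoeff a (fst q) * mcoeff b (snd q) * mcoeff c (snd p))"
      by (simp add: times_mfps_def sum_distrib_right case_prod_unfold)
    also have "\<dots> = (\<Sum>(p, q)\<in>Sigma (index_splits \<alpha>) (\<lambda>p. index_splits (fst p)).
           mcoeff a (fst q) * mcoeff b (snd q) * mcoeff c (snd p))"
      by (subst sum.Sigma) (auto simp: finite_index_splits)
    also have "\<dots> = (\<Sum>(p, q)\<in>Sigma (index_splits \<alpha>) (\<lambda>p. index_splits (snd p)).
           mcoeff a (fst p) * (mcoeff b (fst q) * mcoeff c (snd q)))"
      by (rule sum.reindex_bij_witness[where
            i = "\<lambda>(p, q). ((\<lambda>i. fst p i + fst q i, snd q), (fst p, fst q))" and
            j = "\<lambda>(p, q). ((fst q, \<lambda>i. snd q i + snd p i), (snd q, snd p))"])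
        (auto simp: index_splits_def ac_simps)
    also have "\<dots> = (\<Sum>p\<in>index_splits \<alpha>. \<Sum>q\<in>index_splits (snd p).
           mcoeff a (fst p) * (mcoeff b (fst q) * mcoeff c (snd q)))"
      by (subst sum.Sigma) (auto simp: finite_index_splits)
    also have "\<dots> = mcoeff (a * (b * c)) \<alpha>"
      by (simp add: times_mfps_def sum_distrib_left case_prod_unfold)
    finally show "mcoeff (a * b * c) \<alpha> = mcoeff (a * (b * c)) \<alpha>" .
  qed
  show "a * b = b * a"
    unfolding times_mfps_def
    by (intro arg_cong[where f = Abs_mfps] ext
        sum.reindex_bij_witness[where i = prod.swap and j = prod.swap])
      (auto simp: index_splits_def ac_simps)
  show "1 * a = a"
  proof (rule mfps_eqI)
    fix \<alpha> :: "'a \<Rightarrow> nat"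
    have "mcoeff (1 * a) \<alpha> =
        (\<Sum>p\<in>index_splits \<alpha>. if p = (\<lambda>_. 0, \<alpha>) then mcoeff a \<alpha> else 0)"
      unfolding times_mfps_def one_mfps_def mcoeff_Abs_mfps
      by (rule sum.cong) (auto simp: index_splits_def fun_eq_iff split: if_splits)
    also have "\<dots> = mcoeff a \<alpha>"
      by (subst sum.delta[OF finite_index_splits]) (auto simp: index_splits_def)
    finally show "mcoeff (1 * a) \<alpha> = mcoeff a \<alpha>" .
  qed
  show "(a + b) * c = a * c + b * c"
    by (rule mfps_eqI)
      (simp add: times_mfps_def plus_mfps_def sum.distrib distrib_right case_prod_unfold)
  show "(0::'a mfps) \<noteq> 1"
  proof
    assume "(0::'a mfps) = 1"
    then have "mcoeff (0::'a mfps) (\<lambda>_. 0) = mcoeff (1::'a mfps) (\<lambda>_. 0)"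
      by simp
    then show False
      by (simp add: zero_mfps_def one_mfps_def)
  qed
qed (auto intro!: mfps_eqI simp: plus_mfps_def zero_mfps_def minus_mfps_def uminus_mfps_def)

end


section \<open>The group of formal diffeomorphisms\<close>

text \<open>
  Substitution \<open>f \<circ> G\<close>. When the components of \<open>G\<close> have no constant term, the monomial
  \<open>\<beta>\<close> of \<open>f\<close> contributes only in orders \<open>\<ge> mdeg \<beta>\<close>, so that the finite sum below is
  the whole coefficient; no other case is used.
\<close>

definition mfps_subst :: "'n::finite mfps \<Rightarrow> 'n mfps ^ 'n \<Rightarrow> 'n mfps"
  where "mfps_subst f G = Abs_mfps (\<lambda>\<alpha>. \<Sum>\<beta> | mdeg \<beta> \<le> mdeg \<alpha>.
           mcoeff f \<beta> * mcoeff (\<Prod>j\<in>UNIV. (G $ j) ^ \<beta> j) \<alpha>)"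

definition fcomp :: "'n::finite mfps ^ 'n \<Rightarrow> 'n mfps ^ 'n \<Rightarrow> 'n mfps ^ 'n"
  where "fcomp F G = (\<chi> i. mfps_subst (F $ i) G)"

definition linear_series :: "complex ^ 'n ^ 'n \<Rightarrow> 'n::finite mfps ^ 'n"
  where "linear_series A =
    (\<chi> i. Abs_mfps (\<lambda>\<alpha>. \<Sum>j\<in>UNIV. if \<alpha> = unit_index j then A $ i $ j else 0))"

definition linear_part :: "'n::finite mfps ^ 'n \<Rightarrow> complex ^ 'n ^ 'n"
  where "linear_part F = (\<chi> i j. mcoeff (F $ i) (unit_index j))"

definition formal_diff :: "('n::finite mfps ^ 'n) monoid"
  where "formal_diff =
    \<lparr> carrier = {F. (\<forall>i. mcoeff (F $ i) (\<lambda>_. 0) = 0) \<and> invertible (linear_part F)},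
      mult = fcomp,
      one = linear_series (mat 1) \<rparr>"

definition formal_diff0 :: "('n::finite mfps ^ 'n) set"
  where "formal_diff0 = {h \<in> carrier formal_diff. linear_part h = mat 1}"

definition linearizable_set :: "complex ^ 'n ^ 'n \<Rightarrow> ('n::finite mfps ^ 'n) set"
  where "linearizable_set A =
    {inv\<^bsub>formal_diff\<^esub> h \<otimes>\<^bsub>formal_diff\<^esub> linear_series A \<otimes>\<^bsub>formal_diff\<^esub> h | h. h \<in> formal_diff0}"

definition formal_linearizations ::
    "complex ^ 'n ^ 'n \<Rightarrow> 'n::finite mfps ^ 'n \<Rightarrow> ('n mfps ^ 'n) set"
  where "formal_linearizations A f =
    {h \<in> formal_diff0.
       h \<otimes>\<^bsub>formal_diff\<^esub> f \<otimes>\<^bsub>formal_diff\<^esub> inv\<^bsub>formal_diff\<^esub> h = linear_series A}"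

definition Cent :: "complex ^ 'n ^ 'n \<Rightarrow> ('n::finite mfps ^ 'n) set"
  where "Cent A = {k \<in> formal_diff0.
    k \<otimes>\<^bsub>formal_diff\<^esub> linear_series A = linear_series A \<otimes>\<^bsub>formal_diff\<^esub> k}"


section \<open>Jets and the universal linearization isomorphism\<close>

definition cscale :: "complex \<Rightarrow> 'n::finite mfps ^ 'n \<Rightarrow> 'n mfps ^ 'n"
  where "cscale c F = (\<chi> i. Abs_mfps (\<lambda>\<alpha>. c * mcoeff (F $ i) \<alpha>))"

lemma vector_space_cscale: "vector_space cscale"
  by unfold_locales
    (auto simp: cscale_def vec_eq_iff plus_mfps_def distrib_left distrib_right
       intro!: mfps_eqI)

definition jet :: "nat \<Rightarrow> 'n::finite mfps ^ 'n \<Rightarrow> 'n mfps ^ 'n"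
  where "jet m F = (\<chi> i. Abs_mfps (\<lambda>\<alpha>. if mdeg \<alpha> \<le> m then mcoeff (F $ i) \<alpha> else 0))"

text \<open>
  An element \<open>h\<close> of \<^const>\<open>formal_diff0\<close> is identified with its coefficients of order at
  least \<open>2\<close>, i.e. with \<open>h - I\<close>; its \<open>m\<close>-jet is thereby identified with \<open>jet m (h - I)\<close>,
  whose only possibly nonzero coefficients have order between \<open>2\<close> and \<open>m\<close>. All linear
  structure on \<^const>\<open>formal_diff0\<close> and on its jets refers to these coordinates.
\<close>

definition coords :: "'n::finite mfps ^ 'n \<Rightarrow> 'n mfps ^ 'n"
  where "coords h = h - linear_series (mat 1)"

definition cent_dim :: "complex ^ 'n ^ 'n \<Rightarrow> nat \<Rightarrow> nat"
  where "cent_dim (A :: complex ^ 'n ^ 'n::finite) m =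
    vector_space.dim cscale ((\<lambda>k. jet m (coords k)) ` Cent A)"

definition cent_dim_lim :: "complex ^ 'n ^ 'n::finite \<Rightarrow> enat"
  where "cent_dim_lim A = lim (\<lambda>m. enat (cent_dim A m))"

text \<open>
  \<open>\<complex>\<^sup>d\<close> for \<open>d \<in> \<nat> \<union> {\<infinity>}\<close>: the sequences supported in \<open>{l. l < d}\<close>, hence all sequences
  if \<open>d = \<infinity>\<close>.
\<close>

definition cspace :: "enat \<Rightarrow> (nat \<Rightarrow> complex) set"
  where "cspace d = {s. \<forall>l. d \<le> enat l \<longrightarrow> s l = 0}"

text \<open>
  The possible choices of the linear isomorphism \<open>\<psi>\<close> from \<open>\<complex>\<^sup>d\<close>, \<open>d = cent_dim_lim A\<close>, onto
  the centralizer. The last two clauses say that the basis behind \<open>\<psi>\<close> is compatible with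
  truncation: the \<open>m\<close>-jet of \<open>\<psi> s\<close> depends only on the first \<open>cent_dim A m\<close> coordinates
  of \<open>s\<close>, and is parametrized bijectively by them.
\<close>

definition cent_parametrization ::
    "complex ^ 'n ^ 'n \<Rightarrow> ((nat \<Rightarrow> complex) \<Rightarrow> 'n::finite mfps ^ 'n) \<Rightarrow> bool"
  where "cent_parametrization A \<psi> \<longleftrightarrow>
    bij_betw \<psi> (cspace (cent_dim_lim A)) (Cent A) \<and>
    (\<forall>a b. \<forall>s\<in>cspace (cent_dim_lim A). \<forall>s'\<in>cspace (cent_dim_lim A).
       coords (\<psi> (\<lambda>l. a * s l + b * s' l)) =
         cscale a (coords (\<psi> s)) + cscale b (coords (\<psi> s'))) \<and>
    (\<forall>m. \<forall>s\<in>cspace (cent_dim_lim A).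
       jet m (\<psi> s) = jet m (\<psi> (\<lambda>l. if l < cent_dim A m then s l else 0))) \<and>
    (\<forall>m. bij_betw (\<lambda>s. jet m (\<psi> s)) (cspace (enat (cent_dim A m))) (jet m ` Cent A))"

definition univ_linearization ::
    "((nat \<Rightarrow> complex) \<Rightarrow> 'n::finite mfps ^ 'n) \<Rightarrow> 'n mfps ^ 'n \<Rightarrow>
     (nat \<Rightarrow> complex) \<Rightarrow> 'n mfps ^ 'n"
  where "univ_linearization \<psi> h0 s = \<psi> s \<otimes>\<^bsub>formal_diff\<^esub> h0"


section \<open>Polynomial families\<close>

definition monom_eval :: "complex ^ 'k \<Rightarrow> ('k::finite \<Rightarrow> nat) \<Rightarrow> complex"
  where "monom_eval t i = (\<Prod>j\<in>UNIV. (t $ j) ^ i j)"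

text \<open>
  Polynomial functions of \<open>t\<close> and of finitely many coordinates of \<open>s \<in> S\<close>, of degree at
  most \<open>p\<close> in \<open>t\<close> and at most \<open>q\<close> in \<open>s\<close>. A monomial in the coordinates of \<open>s\<close> is given by
  the multiset \<open>J\<close> of the coordinates occurring in it.
\<close>

definition poly_fun ::
    "(nat \<Rightarrow> complex) set \<Rightarrow> nat \<Rightarrow> nat \<Rightarrow> (complex ^ 'k::finite \<Rightarrow> (nat \<Rightarrow> complex) \<Rightarrow> complex) \<Rightarrow> bool"
  where "poly_fun S p q g \<longleftrightarrow>
    (\<exists>M c. finite M \<and> (\<forall>(i, J)\<in>M. mdeg i \<le> p \<and> size J \<le> q) \<and>
       (\<forall>t. \<forall>s\<in>S. g t s = (\<Sum>(i, J)\<in>M. c i J * monom_eval t i * (\<Prod>l\<in>#J. s l))))"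

definition poly_family ::
    "(nat \<Rightarrow> complex) set \<Rightarrow> (complex ^ 'k::finite \<Rightarrow> (nat \<Rightarrow> complex) \<Rightarrow> 'n::finite mfps ^ 'n) \<Rightarrow> bool"
  where "poly_family S h \<longleftrightarrow>
    (\<forall>a \<alpha>. \<exists>p q. poly_fun S p q (\<lambda>t s. mcoeff (h t s $ a) \<alpha>))"

end

theory Submission
  imports Defs
begin

text \<open>
  A formal diffeomorphism \<open>h\<close> tangent to the identity linearizes \<open>f\<close> if and only if
  \<open>h \<circ> f = A \<circ> h\<close>, and this equation is linear in \<open>h\<close>. It can be solved order by order. If \<open>P\<close>
  solves it up to order \<open>m - 1\<close>, a correction \<open>\<phi>\<close>, homogeneous of degree \<open>m\<close>, extends the
  solution to order \<open>m\<close> exactly when \<open>A \<circ> \<phi> - \<phi> \<circ> A\<close> equals the part of degree \<open>m\<close> of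
  \<open>P \<circ> f - A \<circ> P\<close>. The operator \<open>\<phi> \<mapsto> A \<circ> \<phi> - \<phi> \<circ> A\<close> depends on \<open>A\<close> only, not on \<open>f\<close>.

  For a general \<open>f\<close> the right-hand side may leave the image of this operator. For a linearizable
  \<open>f\<close> it never does, whatever partial solution \<open>P\<close> has been chosen, because \<open>P\<close> is then the jet
  of an actual linearization (lemma \<open>residual_in_range_homological\<close>). So one may fix, once and for
  all, a linear right inverse \<open>g\<^sub>m\<close> of the operator in every degree \<open>m\<close> and always correct by
  \<open>g\<^sub>m\<close> of the residual. As \<open>g\<^sub>m\<close> is linear and independent of \<open>t\<close>, the solution \<open>h\<^sub>0\<close>
  obtained for \<open>f\<^sub>t\<close> has coefficients polynomial in \<open>t\<close> (lemma
  \<open>poly_fun_linearization_approx\<close>). The degree is bounded by a weight count: a coefficient of order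
  \<open>m\<close> of \<open>f\<^sub>t\<close> has degree at most \<open>d\<^sub>0 (m - 1)\<close> in \<open>t\<close>, hence one of order \<open>m\<close> of
  \<open>f\<^sub>t\<^sup>\<beta>\<close> has degree at most \<open>d\<^sub>0 (m - \<bar>\<beta>\<bar>)\<close>, and by induction one of order \<open>m\<close>
  of \<open>h\<^sub>0\<close> has degree at most \<open>d\<^sub>0 m\<close>.

  The other linearizations are \<open>k \<circ> h\<^sub>0\<close> with \<open>k\<close> in the centralizer of \<open>A\<close>. The centralizer
  corresponds to the kernel of the same operator, which is the product of its homogeneous parts.
  Bases of these parts, concatenated by degree, give the linear parametrization \<open>\<psi>\<close> (lemma
  \<open>cent_parametrization_exists\<close>). Composition being linear in its left argument, \<open>\<psi>(s) \<circ> h\<^sub>0\<close>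
  is affine in \<open>s\<close> and keeps the bound on the degree in \<open>t\<close>.
\<close>


section \<open>Coefficients of power series and multi-indices\<close>

lemma mcoeff_0 [simp]: "mcoeff 0 \<alpha> = 0"
  by (simp add: zero_mfps_def)

lemma mcoeff_add [simp]: "mcoeff (f + g) \<alpha> = mcoeff f \<alpha> + mcoeff g \<alpha>"
  by (simp add: plus_mfps_def)

lemma mcoeff_diff [simp]: "mcoeff (f - g) \<alpha> = mcoeff f \<alpha> - mcoeff g \<alpha>"
  by (simp add: minus_mfps_def)

lemma mcoeff_1: "mcoeff 1 \<alpha> = (if \<alpha> = (\<lambda>_. 0) then 1 else 0)"
  by (simp add: one_mfps_def)

lemma mcoeff_mult:
  "mcoeff (f * g) \<alpha> = (\<Sum>p\<in>index_splits \<alpha>. mcoeff f (fst p) * mcoeff g (snd p))"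
  by (simp add: times_mfps_def case_prod_unfold)

lemma mcoeff_sum [simp]: "mcoeff (sum f S) \<alpha> = (\<Sum>x\<in>S. mcoeff (f x) \<alpha>)"
  by (induction S rule: infinite_finite_induct) auto

lemma mcoeff_cscale [simp]: "mcoeff (cscale c F $ a) \<alpha> = c * mcoeff (F $ a) \<alpha>"
  by (simp add: cscale_def)

lemma series_eqI:
  fixes F G :: "'n::finite mfps ^ 'n"
  assumes "\<And>a \<alpha>. mcoeff (F $ a) \<alpha> = mcoeff (G $ a) \<alpha>"
  shows "F = G"
  using assms by (auto simp: vec_eq_iff intro!: mfps_eqI)

lemma mdeg_0 [simp]: "mdeg (\<lambda>_. 0) = 0"
  by (simp add: mdeg_def)

lemma mdeg_eq_0_iff [simp]: "mdeg \<alpha> = 0 \<longleftrightarrow> \<alpha> = (\<lambda>_. 0)"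
  by (auto simp: mdeg_def)

lemma mdeg_add: "mdeg (\<lambda>i. \<alpha> i + \<beta> i) = mdeg \<alpha> + mdeg \<beta>"
  by (simp add: mdeg_def sum.distrib)

lemma mdeg_unit_index [simp]: "mdeg (unit_index j) = 1"
  by (simp add: mdeg_def unit_index_def)

lemma unit_index_eq_iff [simp]: "unit_index i = unit_index j \<longleftrightarrow> i = j"
  by (auto simp: unit_index_def fun_eq_iff split: if_splits)

lemma mdeg_eq_1E:
  fixes \<alpha> :: "'n::finite \<Rightarrow> nat"
  assumes "mdeg \<alpha> = 1"
  obtains j where "\<alpha> = unit_index j"
proof -
  obtain j where j: "\<alpha> j \<noteq> 0"
    using assms by (metis mdeg_eq_0_iff ext one_neq_zero)
  have "mdeg \<alpha> = \<alpha> j + (\<Sum>i\<in>UNIV - {j}. \<alpha> i)"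
    unfolding mdeg_def by (rule sum.remove) auto
  with assms j have "\<alpha> j = 1" "(\<Sum>i\<in>UNIV - {j}. \<alpha> i) = 0"
    by linarith+
  then have "\<alpha> i = unit_index j i" for i
    by (cases "i = j") (auto simp: unit_index_def)
  then have "\<alpha> = unit_index j"
    by (rule ext)
  then show ?thesis
    by (rule that)
qed

lemma mdeg_less_2_cases:
  assumes "mdeg \<alpha> < 2"
  obtains "\<alpha> = (\<lambda>_. 0)" | j where "\<alpha> = unit_index j"
proof -
  from assms have "mdeg \<alpha> = 0 \<or> mdeg \<alpha> = 1"
    by linarith
  then show ?thesis
    by (metis mdeg_eq_0_iff mdeg_eq_1E that)
qed

lemma mdeg_index_splits:
  "p \<in> index_splits \<alpha> \<Longrightarrow> mdeg (fst p) + mdeg (snd p) = mdeg \<alpha>"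
  by (auto simp: index_splits_def mdeg_def simp flip: sum.distrib)

lemma mcoeff_linear_series:
  fixes A :: "complex ^ 'n ^ 'n::finite"
  shows "mcoeff (linear_series A $ i) (unit_index j) = A $ i $ j"
  by (simp add: linear_series_def)

lemma mcoeff_linear_series_eq_0:
  assumes "mdeg \<alpha> \<noteq> 1"
  shows "mcoeff (linear_series A $ i) \<alpha> = 0"
proof -
  have "\<alpha> \<noteq> unit_index j" for j
    using assms by auto
  then show ?thesis
    by (simp add: linear_series_def)
qed

lemma mcoeff_identity_series:
  "mcoeff (linear_series (mat 1) $ i) \<alpha> = (if \<alpha> = unit_index i then 1 else 0)"
proof (cases "mdeg \<alpha> = 1")
  case True
  then show ?thesis
    by (elim mdeg_eq_1E) (auto simp: mcoeff_linear_series mat_def)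
qed (auto simp: mcoeff_linear_series_eq_0)


section \<open>Powers of a tuple of series\<close>

definition mpow :: "'a::comm_monoid_mult ^ 'n::finite \<Rightarrow> ('n \<Rightarrow> nat) \<Rightarrow> 'a"
  where "mpow G \<beta> = (\<Prod>j\<in>UNIV. (G $ j) ^ \<beta> j)"

lemma mcoeff_mfps_subst:
  "mcoeff (mfps_subst f G) \<alpha> = (\<Sum>\<beta> | mdeg \<beta> \<le> mdeg \<alpha>. mcoeff f \<beta> * mcoeff (mpow G \<beta>) \<alpha>)"
  by (simp add: mfps_subst_def mpow_def)

lemma mpow_0 [simp]: "mpow G (\<lambda>_. 0) = 1"
  by (simp add: mpow_def)

lemma mpow_unit_index [simp]: "mpow G (unit_index j) = G $ j"
proof -
  have "mpow G (unit_index j) = (\<Prod>i\<in>UNIV. if i = j then G $ j else 1)"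
    unfolding mpow_def unit_index_def by (rule prod.cong) auto
  then show ?thesis
    by simp
qed

lemma mpow_add: "mpow G (\<lambda>i. \<beta> i + \<gamma> i) = mpow G \<beta> * mpow G \<gamma>"
  by (simp add: mpow_def power_add prod.distrib)

text \<open>
  Every estimate on the coefficients of \<^term>\<open>mpow G \<beta>\<close> below is of one kind: a property
  graded by a weight which adds up under multiplication, so that it is enough to know it, with
  weight \<open>1\<close>, for the components of \<open>G\<close>. The parameter \<open>x\<close> lets the property relate several
  series, or speak about a family of series.
\<close>

lemma mpow_graded:
  fixes G :: "'x \<Rightarrow> 'a::comm_monoid_mult ^ 'n::finite"
  assumes one: "Q 0 (\<lambda>_. 1)"
    and mult: "\<And>v w a b. Q v a \<Longrightarrow> Q w b \<Longrightarrow> Q (v + w) (\<lambda>x. a x * b x)"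
    and G: "\<And>j. Q 1 (\<lambda>x. G x $ j)"
  shows "Q (mdeg \<beta>) (\<lambda>x. mpow (G x) \<beta>)"
proof -
  have pow: "Q n (\<lambda>x. (G x $ j) ^ n)" for n j
  proof (induction n)
    case (Suc n)
    then show ?case
      using mult[OF G[of j] Suc] by simp
  qed (simp add: one)
  have "Q (\<Sum>j\<in>S. \<beta> j) (\<lambda>x. \<Prod>j\<in>S. (G x $ j) ^ \<beta> j)" if "finite S" for S
    using that
  proof (induction S)
    case (insert j S)
    then show ?case
      using mult[OF pow[of "\<beta> j" j] insert.IH] by simp
  qed (simp add: one)
  then show ?thesis
    by (simp add: mdeg_def mpow_def)
qed

definition no_const :: "'n::finite mfps ^ 'n \<Rightarrow> bool"
  where "no_const G \<longleftrightarrow> (\<forall>a. mcoeff (G $ a) (\<lambda>_. 0) = 0)"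

lemma mcoeff_mpow_eq_0:
  assumes "no_const G" "mdeg \<alpha> < mdeg \<beta>"
  shows "mcoeff (mpow G \<beta>) \<alpha> = 0"
proof -
  define Q where "Q w a \<longleftrightarrow> (\<forall>(x::unit) \<alpha>. mdeg \<alpha> < w \<longrightarrow> mcoeff (a x) \<alpha> = 0)"
    for w and a :: "unit \<Rightarrow> 'a mfps"
  have "Q (mdeg \<beta>) (\<lambda>_. mpow G \<beta>)"
  proof (rule mpow_graded)
    show "Q (v + w) (\<lambda>x. a x * b x)" if "Q v a" "Q w b" for v w a b
      unfolding Q_def mcoeff_mult
    proof (intro allI impI sum.neutral ballI)
      fix x :: unit and \<alpha> :: "'a \<Rightarrow> nat" and p
      assume "mdeg \<alpha> < v + w" "p \<in> index_splits \<alpha>"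
      then have "mdeg (fst p) < v \<or> mdeg (snd p) < w"
        using mdeg_index_splits[of p \<alpha>] by linarith
      then show "mcoeff (a x) (fst p) * mcoeff (b x) (snd p) = 0"
        using that by (auto simp: Q_def)
    qed
  qed (use assms in \<open>auto simp: Q_def no_const_def\<close>)
  then show ?thesis
    using assms by (simp add: Q_def)
qed

text \<open>The terms of lowest order of a product are determined by those of the factors.\<close>

lemma mcoeff_mpow_leading:
  assumes "no_const G" "no_const G'"
    and lin: "\<And>a j. mcoeff (G $ a) (unit_index j) = mcoeff (G' $ a) (unit_index j)"
    and "mdeg \<alpha> = mdeg \<beta>"
  shows "mcoeff (mpow G \<beta>) \<alpha> = mcoeff (mpow G' \<beta>) \<alpha>"
proof -
  define Q where "Q w a \<longleftrightarrow> (\<forall>x \<alpha>. mdeg \<alpha> < w \<longrightarrow> mcoeff (a x) \<alpha> = 0) \<and>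
      (\<forall>x y \<alpha>. mdeg \<alpha> = w \<longrightarrow> mcoeff (a x) \<alpha> = mcoeff (a y) \<alpha>)"
    for w and a :: "bool \<Rightarrow> 'a mfps"
  have "Q (mdeg \<beta>) (\<lambda>x. mpow (if x then G else G') \<beta>)"
  proof (rule mpow_graded)
    show "Q (v + w) (\<lambda>x. a x * b x)" if Q: "Q v a" "Q w b" for v w a b
    proof -
      have low: "mcoeff (a x) (fst p) * mcoeff (b x) (snd p) = 0"
        if "mdeg (fst p) < v \<or> mdeg (snd p) < w" for x p
        using Q that by (auto simp: Q_def)
      have "mcoeff (a x * b x) \<alpha> = 0" if "mdeg \<alpha> < v + w" for x \<alpha>
        unfolding mcoeff_mult
      proof (intro sum.neutral ballI low)
        fix p
        assume "p \<in> index_splits \<alpha>"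
        then show "mdeg (fst p) < v \<or> mdeg (snd p) < w"
          using mdeg_index_splits[of p \<alpha>] that by linarith
      qed
      moreover have "mcoeff (a x * b x) \<alpha> = mcoeff (a y * b y) \<alpha>"
        if deg: "mdeg \<alpha> = v + w" for x y \<alpha>
        unfolding mcoeff_mult
      proof (rule sum.cong)
        fix p
        assume "p \<in> index_splits \<alpha>"
        then consider "mdeg (fst p) < v \<or> mdeg (snd p) < w" | "mdeg (fst p) = v" "mdeg (snd p) = w"
          using mdeg_index_splits[of p \<alpha>] deg by linarith
        then show "mcoeff (a x) (fst p) * mcoeff (b x) (snd p) =
            mcoeff (a y) (fst p) * mcoeff (b y) (snd p)"
        proof cases
          case 2
          then have "mcoeff (a x) (fst p) = mcoeff (a y) (fst p)"
            "mcoeff (b x) (snd p) = mcoeff (b y) (snd p)"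
            using Q unfolding Q_def by blast+
          then show ?thesis
            by simp
        qed (simp only: low)
      qed simp
      ultimately show ?thesis
        unfolding Q_def by blast
    qed
  qed (use assms in \<open>auto simp: Q_def no_const_def elim!: mdeg_eq_1E[unfolded One_nat_def]\<close>)
  then have "mcoeff (mpow (if True then G else G') \<beta>) \<alpha> =
      mcoeff (mpow (if False then G else G') \<beta>) \<alpha>"
    using assms(4) unfolding Q_def by blast
  then show ?thesis
    by simp
qed

lemma no_const_linear_series: "no_const (linear_series A)"
  by (simp add: no_const_def mcoeff_linear_series_eq_0)

lemma mcoeff_mpow_linear_series:
  assumes "mdeg \<alpha> \<noteq> mdeg \<beta>"
  shows "mcoeff (mpow (linear_series A) \<beta>) \<alpha> = 0"
proof -
  define Q where "Q w a \<longleftrightarrow> (\<forall>(x::unit) \<alpha>. mdeg \<alpha> \<noteq> w \<longrightarrow> mcoeff (a x) \<alpha> = 0)"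
    for w and a :: "unit \<Rightarrow> 'a mfps"
  have "Q (mdeg \<beta>) (\<lambda>_. mpow (linear_series A) \<beta>)"
  proof (rule mpow_graded)
    show "Q (v + w) (\<lambda>x. a x * b x)" if "Q v a" "Q w b" for v w a b
      unfolding Q_def mcoeff_mult
    proof (intro allI impI sum.neutral ballI)
      fix x :: unit and \<alpha> :: "'a \<Rightarrow> nat" and p
      assume "mdeg \<alpha> \<noteq> v + w" "p \<in> index_splits \<alpha>"
      then have "mdeg (fst p) \<noteq> v \<or> mdeg (snd p) \<noteq> w"
        using mdeg_index_splits[of p \<alpha>] by linarith
      then show "mcoeff (a x) (fst p) * mcoeff (b x) (snd p) = 0"
        using that by (auto simp: Q_def)
    qed
  qed (auto simp: Q_def mcoeff_1 mcoeff_linear_series_eq_0)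
  then show ?thesis
    using assms by (simp add: Q_def)
qed

lemma mpow_identity_series:
  "mpow (linear_series (mat 1)) \<beta> = Abs_mfps (\<lambda>\<alpha>. if \<alpha> = \<beta> then 1 else 0)"
proof -
  define monomial :: "('a \<Rightarrow> nat) \<Rightarrow> 'a mfps"
    where "monomial \<beta> = Abs_mfps (\<lambda>\<alpha>. if \<alpha> = \<beta> then 1 else 0)" for \<beta>
  have mult: "monomial \<beta> * monomial \<gamma> = monomial (\<lambda>i. \<beta> i + \<gamma> i)" for \<beta> \<gamma> :: "'a \<Rightarrow> nat"
  proof (rule mfps_eqI)
    fix \<alpha> :: "'a \<Rightarrow> nat"
    have "mcoeff (monomial \<beta> * monomial \<gamma>) \<alpha> =
        (\<Sum>p\<in>index_splits \<alpha>. if p = (\<beta>, \<gamma>) then 1 else 0)"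
      unfolding mcoeff_mult by (rule sum.cong) (auto simp: monomial_def)
    also have "\<dots> = (if (\<beta>, \<gamma>) \<in> index_splits \<alpha> then 1 else 0)"
      by (simp add: finite_index_splits)
    also have "\<dots> = mcoeff (monomial (\<lambda>i. \<beta> i + \<gamma> i)) \<alpha>"
      by (auto simp: monomial_def index_splits_def fun_eq_iff)
    finally show "mcoeff (monomial \<beta> * monomial \<gamma>) \<alpha> = mcoeff (monomial (\<lambda>i. \<beta> i + \<gamma> i)) \<alpha>" .
  qed
  have one: "monomial (\<lambda>_. 0) = 1"
    by (rule mfps_eqI) (simp add: monomial_def mcoeff_1)
  have pow: "(linear_series (mat 1) $ j) ^ n = monomial (\<lambda>i. n * unit_index j i)" for j :: 'a and n
  proof (induction n)
    case (Suc n)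
    have "linear_series (mat 1) $ j = monomial (unit_index j)"
      by (rule mfps_eqI) (simp add: monomial_def mcoeff_identity_series)
    with Suc show ?case
      by (simp add: mult)
  qed (simp add: one)
  have "(\<Prod>j\<in>S. monomial (\<lambda>i. \<beta> j * unit_index j i)) =
      monomial (\<lambda>i. \<Sum>j\<in>S. \<beta> j * unit_index j i)" if "finite S" for S :: "'a set"
    using that by (induction S) (auto simp: one mult)
  then have "mpow (linear_series (mat 1)) \<beta> = monomial (\<lambda>i. \<Sum>j\<in>UNIV. \<beta> j * unit_index j i)"
    by (simp add: mpow_def pow)
  also have "(\<lambda>i. \<Sum>j\<in>UNIV. \<beta> j * unit_index j i) = \<beta>"
    by (auto simp: unit_index_def fun_eq_iff if_distrib cong: if_cong)
  finally show ?thesis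
    by (simp add: monomial_def)
qed


section \<open>Composition\<close>

lemma mcoeff_fcomp:
  "mcoeff (fcomp F G $ a) \<alpha> =
    (\<Sum>\<beta> | mdeg \<beta> \<le> mdeg \<alpha>. mcoeff (F $ a) \<beta> * mcoeff (mpow G \<beta>) \<alpha>)"
  by (simp add: fcomp_def mcoeff_mfps_subst)

lemma mcoeff_mfps_subst_extend:
  assumes "no_const G" "mdeg \<alpha> \<le> d"
  shows "mcoeff (mfps_subst f G) \<alpha> = (\<Sum>\<beta> | mdeg \<beta> \<le> d. mcoeff f \<beta> * mcoeff (mpow G \<beta>) \<alpha>)"
  unfolding mcoeff_mfps_subst
proof (rule sum.mono_neutral_left)
  show "\<forall>\<beta>\<in>{\<beta>. mdeg \<beta> \<le> d} - {\<beta>. mdeg \<beta> \<le> mdeg \<alpha>}. mcoeff f \<beta> * mcoeff (mpow G \<beta>) \<alpha> = 0"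
    using assms(1) by (auto simp: mcoeff_mpow_eq_0)
qed (use assms(2) finite_mdeg_le in auto)

lemma mfps_subst_1: "mfps_subst 1 G = 1"
proof (rule mfps_eqI)
  fix \<alpha> :: "'a \<Rightarrow> nat"
  have "mcoeff (mfps_subst 1 G) \<alpha> =
      (\<Sum>\<beta> | mdeg \<beta> \<le> mdeg \<alpha>. if \<beta> = (\<lambda>_::'a. 0) then mcoeff 1 \<alpha> else 0)"
    unfolding mcoeff_mfps_subst by (rule sum.cong) (auto simp: mcoeff_1)
  then show "mcoeff (mfps_subst 1 G) \<alpha> = mcoeff 1 \<alpha>"
    by (simp add: finite_mdeg_le)
qed

text \<open>
  The product of the two truncated sums also contains pairs \<open>(\<beta>, \<gamma>)\<close> with
  \<open>\<bar>\<beta>\<bar> + \<bar>\<gamma>\<bar> > \<bar>\<alpha>\<bar>\<close>, but these contribute multiples of \<open>[G\<^sup>\<beta>\<^sup>+\<^sup>\<gamma>]\<^sub>\<alpha> = 0\<close>.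
\<close>

lemma mfps_subst_mult:
  assumes G: "no_const G"
  shows "mfps_subst (f * g) G = mfps_subst f G * mfps_subst g G"
proof (rule mfps_eqI)
  fix \<alpha> :: "'a \<Rightarrow> nat"
  define d where "d = mdeg \<alpha>"
  let ?M = "{\<beta> :: 'a \<Rightarrow> nat. mdeg \<beta> \<le> d}"
  let ?t = "\<lambda>p. mcoeff f (fst p) * mcoeff g (snd p) * mcoeff (mpow G (fst p) * mpow G (snd p)) \<alpha>"
  have "mcoeff (mfps_subst (f * g) G) \<alpha> =
      (\<Sum>\<gamma>\<in>?M. \<Sum>p\<in>index_splits \<gamma>. ?t p)"
    unfolding mcoeff_mfps_subst mcoeff_mult[of f] sum_distrib_right d_def
    by (intro sum.cong refl) (auto simp: index_splits_def simp flip: mpow_add)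
  also have "\<dots> = (\<Sum>x\<in>Sigma ?M index_splits. ?t (snd x))"
    by (subst sum.Sigma) (auto simp: finite_mdeg_le finite_index_splits case_prod_unfold)
  also have "\<dots> = (\<Sum>p | mdeg (fst p) + mdeg (snd p) \<le> d. ?t p)"
    by (rule sum.reindex_bij_witness[where j = snd and i = "\<lambda>p. (\<lambda>i. fst p i + snd p i, p)"])
      (auto simp: index_splits_def mdeg_add dest: mdeg_index_splits)
  also have "\<dots> = (\<Sum>p\<in>?M \<times> ?M. ?t p)"
  proof (rule sum.mono_neutral_left)
    show "\<forall>p\<in>?M \<times> ?M - {p. mdeg (fst p) + mdeg (snd p) \<le> d}. ?t p = 0"
      using G by (auto simp: d_def mdeg_add simp flip: mpow_add intro!: mcoeff_mpow_eq_0)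
  qed (auto simp: finite_mdeg_le)
  also have "\<dots> = (\<Sum>p\<in>?M \<times> ?M. \<Sum>q\<in>index_splits \<alpha>.
      (mcoeff f (fst p) * mcoeff (mpow G (fst p)) (fst q)) *
      (mcoeff g (snd p) * mcoeff (mpow G (snd p)) (snd q)))"
    by (simp add: mcoeff_mult sum_distrib_left mult_ac)
  also have "\<dots> = (\<Sum>q\<in>index_splits \<alpha>. \<Sum>p\<in>?M \<times> ?M.
      (mcoeff f (fst p) * mcoeff (mpow G (fst p)) (fst q)) *
      (mcoeff g (snd p) * mcoeff (mpow G (snd p)) (snd q)))"
    by (rule sum.swap)
  also have "\<dots> = (\<Sum>q\<in>index_splits \<alpha>. mcoeff (mfps_subst f G) (fst q) * mcoeff (mfps_subst g G) (snd q))"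
  proof (rule sum.cong)
    fix q
    assume "q \<in> index_splits \<alpha>"
    then have "mdeg (fst q) \<le> d" "mdeg (snd q) \<le> d"
      using mdeg_index_splits[of q \<alpha>] by (auto simp: d_def)
    then show "(\<Sum>p\<in>?M \<times> ?M. (mcoeff f (fst p) * mcoeff (mpow G (fst p)) (fst q)) *
        (mcoeff g (snd p) * mcoeff (mpow G (snd p)) (snd q))) =
        mcoeff (mfps_subst f G) (fst q) * mcoeff (mfps_subst g G) (snd q)"
      by (simp add: mcoeff_mfps_subst_extend[OF G] sum_product sum.cartesian_product case_prod_unfold)
  qed simp
  finally show "mcoeff (mfps_subst (f * g) G) \<alpha> = mcoeff (mfps_subst f G * mfps_subst g G) \<alpha>"
    by (simp add: mcoeff_mult)
qed

lemma mfps_subst_mpow: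
  assumes "no_const H"
  shows "mfps_subst (mpow G \<beta>) H = mpow (fcomp G H) \<beta>"
proof -
  have pow: "mfps_subst (f ^ n) H = mfps_subst f H ^ n" for f n
    by (induction n) (auto simp: mfps_subst_1 mfps_subst_mult[OF assms])
  have "mfps_subst (\<Prod>j\<in>S. (G $ j) ^ \<beta> j) H = (\<Prod>j\<in>S. mfps_subst (G $ j) H ^ \<beta> j)"
    if "finite S" for S
    using that by (induction S) (auto simp: mfps_subst_1 mfps_subst_mult[OF assms] pow)
  then show ?thesis
    by (simp add: mpow_def fcomp_def)
qed

text \<open>
  Substituting \<open>H\<close> is a ring homomorphism, hence maps the monomial \<open>G\<^sup>\<beta>\<close> to
  \<open>(G \<circ> H)\<^sup>\<beta>\<close>; associativity follows by linearity in \<open>F\<close>.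
\<close>

lemma fcomp_assoc:
  assumes G: "no_const G" and H: "no_const H"
  shows "fcomp (fcomp F G) H = fcomp F (fcomp G H)"
proof (rule series_eqI)
  fix a and \<alpha> :: "'a \<Rightarrow> nat"
  let ?M = "{\<beta> :: 'a \<Rightarrow> nat. mdeg \<beta> \<le> mdeg \<alpha>}"
  have "mcoeff (fcomp (fcomp F G) H $ a) \<alpha> = (\<Sum>\<gamma>\<in>?M. (\<Sum>\<beta>\<in>?M.
      mcoeff (F $ a) \<beta> * mcoeff (mpow G \<beta>) \<gamma>) * mcoeff (mpow H \<gamma>) \<alpha>)"
    unfolding mcoeff_fcomp[of "fcomp F G"]
    by (intro sum.cong refl) (simp add: fcomp_def mcoeff_mfps_subst_extend[OF G])
  also have "\<dots> = (\<Sum>\<beta>\<in>?M. \<Sum>\<gamma>\<in>?M.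
      mcoeff (F $ a) \<beta> * mcoeff (mpow G \<beta>) \<gamma> * mcoeff (mpow H \<gamma>) \<alpha>)"
    unfolding sum_distrib_right by (rule sum.swap)
  also have "\<dots> = (\<Sum>\<beta>\<in>?M. mcoeff (F $ a) \<beta> * mcoeff (mfps_subst (mpow G \<beta>) H) \<alpha>)"
    by (simp add: mcoeff_mfps_subst sum_distrib_left mult.assoc)
  finally show "mcoeff (fcomp (fcomp F G) H $ a) \<alpha> = mcoeff (fcomp F (fcomp G H) $ a) \<alpha>"
    by (simp add: mcoeff_fcomp mfps_subst_mpow[OF H])
qed

lemma no_const_fcomp:
  assumes "no_const F"
  shows "no_const (fcomp F G)"
  using assms by (simp add: no_const_def mcoeff_fcomp)

lemma fcomp_identity_right: "fcomp F (linear_series (mat 1)) = F"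
proof (rule series_eqI)
  fix a and \<alpha> :: "'a \<Rightarrow> nat"
  have "mcoeff (fcomp F (linear_series (mat 1)) $ a) \<alpha> =
      (\<Sum>\<beta> | mdeg \<beta> \<le> mdeg \<alpha>. if \<beta> = \<alpha> then mcoeff (F $ a) \<alpha> else 0)"
    unfolding mcoeff_fcomp by (rule sum.cong) (auto simp: mpow_identity_series)
  then show "mcoeff (fcomp F (linear_series (mat 1)) $ a) \<alpha> = mcoeff (F $ a) \<alpha>"
    by (simp add: finite_mdeg_le)
qed

lemma fcomp_add: "fcomp (F + G) H = fcomp F H + fcomp G H"
  by (rule series_eqI) (simp add: mcoeff_fcomp distrib_right sum.distrib)

lemma fcomp_diff: "fcomp (F - G) H = fcomp F H - fcomp G H"
  by (rule series_eqI) (simp add: mcoeff_fcomp left_diff_distrib sum_subtractf)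

lemma fcomp_cscale: "fcomp (cscale c F) H = cscale c (fcomp F H)"
  by (rule series_eqI) (simp add: mcoeff_fcomp sum_distrib_left mult.assoc)

lemma mcoeff_fcomp_cong:
  assumes "\<And>\<beta>. mdeg \<beta> \<le> mdeg \<alpha> \<Longrightarrow> mcoeff (F $ a) \<beta> = mcoeff (G $ a) \<beta>"
  shows "mcoeff (fcomp F H $ a) \<alpha> = mcoeff (fcomp G H $ a) \<alpha>"
  unfolding mcoeff_fcomp by (rule sum.cong) (auto simp: assms)

definition mat_act :: "complex ^ 'n ^ 'n \<Rightarrow> 'n::finite mfps ^ 'n \<Rightarrow> 'n mfps ^ 'n"
  where "mat_act A F = (\<chi> i. Abs_mfps (\<lambda>\<alpha>. \<Sum>j\<in>UNIV. A $ i $ j * mcoeff (F $ j) \<alpha>))"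

lemma mcoeff_mat_act: "mcoeff (mat_act A F $ i) \<alpha> = (\<Sum>j\<in>UNIV. A $ i $ j * mcoeff (F $ j) \<alpha>)"
  by (simp add: mat_act_def)

lemma fcomp_linear_part:
  fixes F :: "'n::finite mfps ^ 'n"
  assumes "no_const F" "no_const G" "mdeg \<alpha> = 1"
  shows "mcoeff (fcomp F G $ i) \<alpha> = (\<Sum>j\<in>UNIV. mcoeff (F $ i) (unit_index j) * mcoeff (G $ j) \<alpha>)"
proof -
  have "mcoeff (fcomp F G $ i) \<alpha> =
      (\<Sum>\<beta>\<in>range unit_index. mcoeff (F $ i) \<beta> * mcoeff (mpow G \<beta>) \<alpha>)"
    unfolding mcoeff_fcomp
  proof (rule sum.mono_neutral_right)
    show "\<forall>\<beta>\<in>{\<beta>. mdeg \<beta> \<le> mdeg \<alpha>} - range unit_index.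
        mcoeff (F $ i) \<beta> * mcoeff (mpow G \<beta>) \<alpha> = 0"
    proof
      fix \<beta> :: "'n \<Rightarrow> nat"
      assume "\<beta> \<in> {\<beta>. mdeg \<beta> \<le> mdeg \<alpha>} - range unit_index"
      then have "mdeg \<beta> < 2" "\<beta> \<notin> range unit_index"
        using assms(3) by auto
      then have "\<beta> = (\<lambda>_. 0)"
        by (auto elim!: mdeg_less_2_cases[of \<beta>])
      then show "mcoeff (F $ i) \<beta> * mcoeff (mpow G \<beta>) \<alpha> = 0"
        using assms(1) by (simp add: no_const_def)
    qed
  qed (use assms(3) in \<open>auto simp: finite_mdeg_le\<close>)
  also have "\<dots> = (\<Sum>j\<in>UNIV. mcoeff (F $ i) (unit_index j) * mcoeff (G $ j) \<alpha>)"
    by (subst sum.reindex) (auto simp: inj_on_def)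
  finally show ?thesis .
qed

lemma fcomp_linear_series_left:
  fixes G :: "'n::finite mfps ^ 'n"
  assumes "no_const G"
  shows "fcomp (linear_series A) G = mat_act A G"
proof (rule series_eqI)
  fix i and \<alpha> :: "'n \<Rightarrow> nat"
  have "mcoeff (fcomp (linear_series A) G $ i) \<alpha> =
      (\<Sum>\<beta>\<in>range unit_index. mcoeff (linear_series A $ i) \<beta> * mcoeff (mpow G \<beta>) \<alpha>)"
    unfolding mcoeff_fcomp
  proof (rule sum.mono_neutral_cong)
    show "mcoeff (linear_series A $ i) \<beta> * mcoeff (mpow G \<beta>) \<alpha> = 0"
      if "\<beta> \<in> {\<beta>. mdeg \<beta> \<le> mdeg \<alpha>} - range unit_index" for \<beta>
      using that by (auto elim!: mdeg_eq_1E intro!: mcoeff_linear_series_eq_0)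
    show "mcoeff (linear_series A $ i) \<beta> * mcoeff (mpow G \<beta>) \<alpha> = 0"
      if "\<beta> \<in> range unit_index - {\<beta>. mdeg \<beta> \<le> mdeg \<alpha>}" for \<beta>
      using that assms by (auto simp: no_const_def not_less_eq_eq)
  qed (auto simp: finite_mdeg_le)
  also have "\<dots> = mcoeff (mat_act A G $ i) \<alpha>"
    by (subst sum.reindex) (auto simp: inj_on_def mcoeff_mat_act mcoeff_linear_series)
  finally show "mcoeff (fcomp (linear_series A) G $ i) \<alpha> = mcoeff (mat_act A G $ i) \<alpha>" .
qed

lemma mat_act_identity: "mat_act (mat 1) F = F"
  by (rule series_eqI) (simp add: mcoeff_mat_act mat_def if_distrib if_distribR cong: if_cong)


section \<open>The group structure\<close>

lemma (in monoid) conjugation_iff: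
  assumes h: "h \<in> Units G" and f: "f \<in> carrier G" and a: "a \<in> carrier G"
  shows "h \<otimes> f \<otimes> inv h = a \<longleftrightarrow> h \<otimes> f = a \<otimes> h"
    and "f = inv h \<otimes> a \<otimes> h \<longleftrightarrow> h \<otimes> f = a \<otimes> h"
    and "f \<otimes> inv h = inv h \<otimes> a \<longleftrightarrow> h \<otimes> f = a \<otimes> h"
proof -
  note [simp] = h f a Units_closed[OF h] Units_inv_closed[OF h]
  have right: "x \<otimes> h \<otimes> inv h = x" "x \<otimes> inv h \<otimes> h = x" if "x \<in> carrier G" for x
    using that by (simp_all add: m_assoc)
  have left: "h \<otimes> (inv h \<otimes> x) = x" "inv h \<otimes> (h \<otimes> x) = x" if "x \<in> carrier G" for x
    using that by (simp_all flip: m_assoc)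
  show "h \<otimes> f \<otimes> inv h = a \<longleftrightarrow> h \<otimes> f = a \<otimes> h"
    using right(1)[of a] right(2)[of "h \<otimes> f"] by auto
  show "f = inv h \<otimes> a \<otimes> h \<longleftrightarrow> h \<otimes> f = a \<otimes> h"
    using left(1)[of "a \<otimes> h"] left(2)[of f] by (auto simp: m_assoc)
  have "h \<otimes> f = a \<otimes> h" if "f \<otimes> inv h = inv h \<otimes> a"
  proof -
    have "h \<otimes> f = h \<otimes> (f \<otimes> inv h \<otimes> h)"
      by (simp add: right)
    also have "\<dots> = a \<otimes> h"
      using that by (simp add: m_assoc left)
    finally show ?thesis .
  qed
  moreover have "f \<otimes> inv h = inv h \<otimes> a" if "h \<otimes> f = a \<otimes> h"
  proof -
    have "f \<otimes> inv h = inv h \<otimes> (h \<otimes> f) \<otimes> inv h"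
      by (simp add: left)
    also have "\<dots> = inv h \<otimes> a"
      using that by (simp add: m_assoc)
    finally show ?thesis .
  qed
  ultimately show "f \<otimes> inv h = inv h \<otimes> a \<longleftrightarrow> h \<otimes> f = a \<otimes> h"
    by blast
qed

lemma linear_part_linear_series [simp]: "linear_part (linear_series A) = A"
  by (simp add: linear_part_def vec_eq_iff mcoeff_linear_series)

lemma linear_part_fcomp:
  fixes F G :: "'n::finite mfps ^ 'n"
  assumes "no_const F" "no_const G"
  shows "linear_part (fcomp F G) = linear_part F ** linear_part G"
  using assms by (simp add: linear_part_def vec_eq_iff matrix_matrix_mult_def fcomp_linear_part)

lemma invertible_identity [simp]: "invertible (mat 1 :: complex ^ 'n ^ 'n)"
  unfolding invertible_def by (rule exI[of _ "mat 1"]) simp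

lemma carrier_formal_diff:
  "F \<in> carrier formal_diff \<longleftrightarrow> no_const F \<and> invertible (linear_part F)"
  by (simp add: formal_diff_def no_const_def)

lemma mult_formal_diff [simp]: "F \<otimes>\<^bsub>formal_diff\<^esub> G = fcomp F G"
  by (simp add: formal_diff_def)

lemma one_formal_diff [simp]: "\<one>\<^bsub>formal_diff\<^esub> = linear_series (mat 1)"
  by (simp add: formal_diff_def)

lemma fcomp_identity_left: "no_const F \<Longrightarrow> fcomp (linear_series (mat 1)) F = F"
  by (simp add: fcomp_linear_series_left mat_act_identity)

interpretation formal_diff: monoid "formal_diff :: ('n::finite mfps ^ 'n) monoid"
proof (rule monoidI)
  fix F G :: "'n mfps ^ 'n"
  assume "F \<in> carrier formal_diff" "G \<in> carrier formal_diff"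
  then show "F \<otimes>\<^bsub>formal_diff\<^esub> G \<in> carrier formal_diff"
    by (simp add: carrier_formal_diff linear_part_fcomp no_const_fcomp invertible_mult)
next
  show "\<one>\<^bsub>formal_diff\<^esub> \<in> (carrier formal_diff :: ('n mfps ^ 'n) set)"
    by (simp add: carrier_formal_diff no_const_linear_series)
qed (auto simp: carrier_formal_diff fcomp_assoc fcomp_identity_left fcomp_identity_right)

lemma formal_diff0_iff: "h \<in> formal_diff0 \<longleftrightarrow> no_const h \<and> linear_part h = mat 1"
  by (auto simp: formal_diff0_def carrier_formal_diff)

lemma formal_diff0_iff_low_order:
  fixes h :: "'n::finite mfps ^ 'n"
  shows "h \<in> formal_diff0 \<longleftrightarrow>
    (\<forall>a \<alpha>. mdeg \<alpha> < 2 \<longrightarrow> mcoeff (h $ a) \<alpha> = mcoeff (linear_series (mat 1) $ a) \<alpha>)"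
    (is "_ \<longleftrightarrow> ?low")
proof
  assume h: "h \<in> formal_diff0"
  then have "mcoeff (h $ a) (unit_index j) = mat 1 $ a $ j" for a j
    by (simp add: formal_diff0_iff linear_part_def vec_eq_iff)
  with h show ?low
    by (auto simp: formal_diff0_iff no_const_def mcoeff_linear_series mcoeff_linear_series_eq_0
        elim!: mdeg_less_2_cases)
next
  assume ?low
  then have low: "mcoeff (h $ a) \<alpha> = mcoeff (linear_series (mat 1) $ a) \<alpha>" if "mdeg \<alpha> < 2" for a \<alpha>
    using that by blast
  show "h \<in> formal_diff0"
    by (simp add: formal_diff0_iff no_const_def linear_part_def vec_eq_iff low mcoeff_linear_series
        mcoeff_linear_series_eq_0)
qed

lemma formal_diff0_fcomp:
  "g \<in> formal_diff0 \<Longrightarrow> h \<in> formal_diff0 \<Longrightarrow> fcomp g h \<in> formal_diff0"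
  by (simp add: formal_diff0_iff no_const_fcomp linear_part_fcomp)

text \<open>
  On the terms of lowest order of \<^term>\<open>F\<close>, composition with \<^term>\<open>G\<close> only sees the linear
  part of \<^term>\<open>G\<close>.
\<close>

lemma mcoeff_fcomp_leading:
  fixes F :: "'n::finite mfps ^ 'n"
  assumes "no_const G" "no_const G'" and lin: "linear_part G = linear_part G'"
    and F: "\<And>\<beta>. mdeg \<beta> < mdeg \<alpha> \<Longrightarrow> mcoeff (F $ a) \<beta> = 0"
  shows "mcoeff (fcomp F G $ a) \<alpha> = mcoeff (fcomp F G' $ a) \<alpha>"
  unfolding mcoeff_fcomp
proof (rule sum.cong)
  fix \<beta> :: "'n \<Rightarrow> nat"
  assume "\<beta> \<in> {\<beta>. mdeg \<beta> \<le> mdeg \<alpha>}"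
  then consider "mdeg \<beta> < mdeg \<alpha>" | "mdeg \<alpha> = mdeg \<beta>"
    by fastforce
  then show "mcoeff (F $ a) \<beta> * mcoeff (mpow G \<beta>) \<alpha> = mcoeff (F $ a) \<beta> * mcoeff (mpow G' \<beta>) \<alpha>"
  proof cases
    case 2
    have "mcoeff (G $ i) (unit_index j) = mcoeff (G' $ i) (unit_index j)" for i j
      using lin by (simp add: linear_part_def vec_eq_iff)
    then show ?thesis
      using mcoeff_mpow_leading[OF assms(1,2) _ 2] by simp
  qed (simp add: F)
qed simp

lemma mcoeff_fcomp_eq_0:
  "(\<And>\<beta>. mdeg \<beta> \<le> mdeg \<alpha> \<Longrightarrow> mcoeff (F $ a) \<beta> = 0) \<Longrightarrow> mcoeff (fcomp F G $ a) \<alpha> = 0"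
  by (simp add: mcoeff_fcomp)

lemma fcomp_sum: "fcomp (\<Sum>x\<in>S. F x) G = (\<Sum>x\<in>S. fcomp (F x) G)"
proof (induction S rule: infinite_finite_induct)
  case (insert x S)
  then show ?case
    by (simp add: fcomp_add)
qed (auto intro!: series_eqI simp: mcoeff_fcomp)

text \<open>
  The operator \<open>N k = k - k \<circ> h\<close> raises the order of vanishing, so that the geometric series
  \<open>\<Sum>n. N\<^sup>n\<close> converges and inverts \<open>k \<mapsto> k \<circ> h\<close>; applied to the identity, it gives a left inverse
  of \<open>h\<close>.
\<close>

lemma formal_diff0_left_inverse:
  fixes h :: "'n::finite mfps ^ 'n"
  assumes h: "h \<in> formal_diff0"
  obtains k where "k \<in> formal_diff0" "fcomp k h = linear_series (mat 1)"
proof -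
  define u where "u n = ((\<lambda>k. k - fcomp k h) ^^ n) (linear_series (mat 1))" for n
  have u_Suc: "u (Suc n) = u n - fcomp (u n) h" for n
    by (simp add: u_def)
  have u_vanish: "mcoeff (u n $ a) \<alpha> = 0" if "mdeg \<alpha> \<le> n" for n a \<alpha>
    using that
  proof (induction n arbitrary: \<alpha>)
    case 0
    then show ?case
      by (simp add: u_def mcoeff_linear_series_eq_0)
  next
    case (Suc n)
    show ?case
    proof (cases "mdeg \<alpha> \<le> n")
      case True
      then show ?thesis
        by (simp add: u_Suc Suc.IH mcoeff_fcomp_eq_0)
    next
      case False
      have "mcoeff (fcomp (u n) h $ a) \<alpha> = mcoeff (fcomp (u n) (linear_series (mat 1)) $ a) \<alpha>"
        using h Suc by (intro mcoeff_fcomp_leading) (auto simp: formal_diff0_iff no_const_linear_series)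
      then show ?thesis
        by (simp add: u_Suc fcomp_identity_right)
    qed
  qed
  define k :: "'n mfps ^ 'n"
    where "k = (\<chi> a. Abs_mfps (\<lambda>\<alpha>. \<Sum>n<Suc (mdeg \<alpha>). mcoeff (u n $ a) \<alpha>))"
  have k_partial_sum: "mcoeff (k $ a) \<alpha> = mcoeff ((\<Sum>n<Suc m. u n) $ a) \<alpha>" if "mdeg \<alpha> \<le> m" for a \<alpha> m
  proof -
    have "(\<Sum>n<Suc (mdeg \<alpha>). mcoeff (u n $ a) \<alpha>) = (\<Sum>n<Suc m. mcoeff (u n $ a) \<alpha>)"
      using that by (intro sum.mono_neutral_left) (auto intro: u_vanish)
    then show ?thesis
      by (simp add: k_def)
  qed
  have inverse: "fcomp k h = linear_series (mat 1)"
  proof (rule series_eqI)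
    fix a and \<alpha> :: "'n \<Rightarrow> nat"
    let ?m = "Suc (mdeg \<alpha>)"
    have "mcoeff (fcomp k h $ a) \<alpha> = mcoeff (fcomp (\<Sum>n<?m. u n) h $ a) \<alpha>"
      by (rule mcoeff_fcomp_cong) (rule k_partial_sum)
    also have "fcomp (\<Sum>n<?m. u n) h = (\<Sum>n<?m. u n - u (Suc n))"
        by (simp only: fcomp_sum u_Suc diff_diff_eq2 add_diff_cancel_left')
    also have "\<dots> = u 0 - u ?m"
      by (rule sum_lessThan_telescope')
    also have "mcoeff (\<dots> $ a) \<alpha> = mcoeff (u 0 $ a) \<alpha>"
      by (simp add: u_vanish)
    finally show "mcoeff (fcomp k h $ a) \<alpha> = mcoeff (linear_series (mat 1) $ a) \<alpha>"
      by (simp add: u_def)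
  qed
  have "no_const k"
    using u_vanish[of "\<lambda>_. 0" 0] by (simp add: no_const_def k_def)
  moreover have "linear_part k = mat 1"
    using h linear_part_fcomp[OF \<open>no_const k\<close>, of h] by (simp add: inverse formal_diff0_iff)
  ultimately show ?thesis
    using that inverse by (simp add: formal_diff0_iff)
qed

lemma formal_diff0_Units: "h \<in> formal_diff0 \<Longrightarrow> h \<in> Units formal_diff"
proof -
  assume h: "h \<in> formal_diff0"
  then obtain k where k: "k \<in> formal_diff0" "fcomp k h = linear_series (mat 1)"
    by (rule formal_diff0_left_inverse)
  from k(1) obtain l where l: "l \<in> formal_diff0" "fcomp l k = linear_series (mat 1)"
    by (rule formal_diff0_left_inverse)
  have "l = fcomp l (fcomp k h)"
    by (simp add: k fcomp_identity_right)
  also have "\<dots> = h"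
    using h k(1) l by (simp add: formal_diff0_iff fcomp_identity_left flip: fcomp_assoc)
  finally have "fcomp h k = linear_series (mat 1)"
    using l by simp
  with h k show "h \<in> Units formal_diff"
    by (auto simp: Units_def formal_diff0_def)
qed

lemma formal_linearizations_iff:
  assumes f: "f \<in> carrier formal_diff" and A: "invertible A"
  shows "h \<in> formal_linearizations A f \<longleftrightarrow> h \<in> formal_diff0 \<and> fcomp h f = mat_act A h"
proof (cases "h \<in> formal_diff0")
  case True
  let ?i = "inv\<^bsub>formal_diff\<^esub> h"
  have h: "h \<in> Units formal_diff" "h \<in> carrier formal_diff" "no_const h"
    using True formal_diff0_Units by (auto simp: formal_diff0_def carrier_formal_diff)
  then have i: "?i \<in> carrier formal_diff"
    by simp
  have A': "linear_series A \<in> carrier formal_diff"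
    using A by (simp add: carrier_formal_diff no_const_linear_series)
  have "h \<otimes>\<^bsub>formal_diff\<^esub> f \<otimes>\<^bsub>formal_diff\<^esub> ?i = linear_series A \<longleftrightarrow>
      h \<otimes>\<^bsub>formal_diff\<^esub> f = linear_series A \<otimes>\<^bsub>formal_diff\<^esub> h"
    by (rule formal_diff.conjugation_iff(1)[OF h(1) f A'])
  then show ?thesis
    using True h by (simp add: formal_linearizations_def fcomp_linear_series_left)
qed (simp add: formal_linearizations_def)

lemma linearizable_set_linearization:
  assumes f: "f \<in> linearizable_set A" and A: "invertible A"
  obtains h where "f \<in> carrier formal_diff" "h \<in> formal_linearizations A f"
proof -
  obtain h where h: "h \<in> formal_diff0"
    and f_eq: "f = inv\<^bsub>formal_diff\<^esub> h \<otimes>\<^bsub>formal_diff\<^esub> linear_series A \<otimes>\<^bsub>formal_diff\<^esub> h"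
    using f by (auto simp: linearizable_set_def)
  have hU: "h \<in> Units formal_diff" "h \<in> carrier formal_diff" "no_const h"
    using h formal_diff0_Units by (auto simp: formal_diff0_def carrier_formal_diff)
  have A': "linear_series A \<in> carrier formal_diff"
    using A by (simp add: carrier_formal_diff no_const_linear_series)
  have f': "f \<in> carrier formal_diff"
    unfolding f_eq by (intro formal_diff.m_closed formal_diff.Units_inv_closed hU A')
  have "h \<otimes>\<^bsub>formal_diff\<^esub> f = linear_series A \<otimes>\<^bsub>formal_diff\<^esub> h"
    using formal_diff.conjugation_iff(2)[OF hU(1) f' A'] f_eq by simp
  then have "h \<in> formal_linearizations A f"
    using f' A h hU by (simp add: formal_linearizations_iff fcomp_linear_series_left)
  with f' show ?thesis
    by (rule that)
qed


section \<open>Homogeneous parts and the homological operator\<close>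

interpretation series: vector_space_pair
  "cscale :: complex \<Rightarrow> 'n::finite mfps ^ 'n \<Rightarrow> _"
  "cscale :: complex \<Rightarrow> 'n::finite mfps ^ 'n \<Rightarrow> _"
  by (intro vector_space_pair.intro vector_space_cscale)

definition hom_part :: "nat \<Rightarrow> 'n::finite mfps ^ 'n \<Rightarrow> 'n mfps ^ 'n"
  where "hom_part m F = (\<chi> a. Abs_mfps (\<lambda>\<alpha>. if mdeg \<alpha> = m then mcoeff (F $ a) \<alpha> else 0))"

lemma mcoeff_hom_part [simp]:
  "mcoeff (hom_part m F $ a) \<alpha> = (if mdeg \<alpha> = m then mcoeff (F $ a) \<alpha> else 0)"
  by (simp add: hom_part_def)

lemma mcoeff_jet [simp]:
  "mcoeff (jet m F $ a) \<alpha> = (if mdeg \<alpha> \<le> m then mcoeff (F $ a) \<alpha> else 0)"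
  by (simp add: jet_def)

lemma hom_part_hom_part: "hom_part m (hom_part k F) = (if m = k then hom_part m F else 0)"
  by (rule series_eqI) simp

lemma jet_eq_sum_hom_part: "jet m F = (\<Sum>j\<le>m. hom_part j F)"
  by (rule series_eqI) simp

text \<open>
  When \<open>f\<close> has linear part \<open>A\<close>, the operator \<open>h \<mapsto> A \<circ> h - h \<circ> f\<close> acts on terms of
  lowest order as this operator does. It preserves the degree, its kernel gives the centralizer of
  \<open>A\<close>, and its failure to be surjective (the resonances of \<open>A\<close>) is the obstruction to solving
  \<open>h \<circ> f = A \<circ> h\<close> order by order.
\<close>

definition homological :: "complex ^ 'n ^ 'n \<Rightarrow> 'n::finite mfps ^ 'n \<Rightarrow> 'n mfps ^ 'n"
  where "homological A F = mat_act A F - fcomp F (linear_series A)"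

lemma mat_act_add: "mat_act A (F + G) = mat_act A F + mat_act A G"
  by (rule series_eqI) (simp add: mcoeff_mat_act distrib_left sum.distrib)

lemma mat_act_cscale: "mat_act A (cscale c F) = cscale c (mat_act A F)"
  by (rule series_eqI) (simp add: mcoeff_mat_act sum_distrib_left mult_ac)

lemma mat_act_fcomp: "mat_act A (fcomp F G) = fcomp (mat_act A F) G"
proof (rule series_eqI)
  fix i and \<alpha> :: "'a \<Rightarrow> nat"
  show "mcoeff (mat_act A (fcomp F G) $ i) \<alpha> = mcoeff (fcomp (mat_act A F) G $ i) \<alpha>"
    unfolding mcoeff_mat_act mcoeff_fcomp sum_distrib_left sum_distrib_right
    by (subst sum.swap) (simp add: mult.assoc)
qed

lemma linear_homological: "Vector_Spaces.linear cscale cscale (homological A)"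
  unfolding Vector_Spaces.linear_iff
  by (auto simp: vector_space_cscale homological_def mat_act_add mat_act_cscale fcomp_add fcomp_cscale
      series.vs1.scale_right_diff_distrib)

lemma mcoeff_homological:
  fixes F :: "'n::finite mfps ^ 'n"
  shows "mcoeff (homological A F $ a) \<alpha> = mcoeff (mat_act A F $ a) \<alpha> -
    (\<Sum>\<beta> | mdeg \<beta> = mdeg \<alpha>. mcoeff (F $ a) \<beta> * mcoeff (mpow (linear_series A) \<beta>) \<alpha>)"
proof -
  have "mcoeff (fcomp F (linear_series A) $ a) \<alpha> =
      (\<Sum>\<beta> | mdeg \<beta> = mdeg \<alpha>. mcoeff (F $ a) \<beta> * mcoeff (mpow (linear_series A) \<beta>) \<alpha>)"
    unfolding mcoeff_fcomp
    by (rule sum.mono_neutral_right) (auto simp: finite_mdeg_le mcoeff_mpow_linear_series)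
  then show ?thesis
    by (simp add: homological_def)
qed

lemma mcoeff_homological_cong:
  assumes "\<And>a \<beta>. mdeg \<beta> = mdeg \<alpha> \<Longrightarrow> mcoeff (F $ a) \<beta> = mcoeff (G $ a) \<beta>"
  shows "mcoeff (homological A F $ a) \<alpha> = mcoeff (homological A G $ a) \<alpha>"
  unfolding mcoeff_homological mcoeff_mat_act
  by (intro arg_cong2[where f = minus] sum.cong) (auto simp: assms)

lemma homological_0: "homological A 0 = 0"
  using series.linear_0[OF linear_homological] .

lemma hom_part_homological: "hom_part m (homological A F) = homological A (hom_part m F)"
proof (rule series_eqI)
  fix a and \<alpha> :: "'a \<Rightarrow> nat"
  show "mcoeff (hom_part m (homological A F) $ a) \<alpha> = mcoeff (homological A (hom_part m F) $ a) \<alpha>"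
  proof (cases "mdeg \<alpha> = m")
    case True
    then show ?thesis
      using mcoeff_homological_cong[of \<alpha> F "hom_part m F" A a] by simp
  next
    case False
    then show ?thesis
      using mcoeff_homological_cong[of \<alpha> "hom_part m F" 0 A a] by (simp add: homological_0)
  qed
qed

lemma jet_homological: "jet m (homological A F) = homological A (jet m F)"
proof (rule series_eqI)
  fix a and \<alpha> :: "'a \<Rightarrow> nat"
  show "mcoeff (jet m (homological A F) $ a) \<alpha> = mcoeff (homological A (jet m F) $ a) \<alpha>"
  proof (cases "mdeg \<alpha> \<le> m")
    case True
    then show ?thesis
      using mcoeff_homological_cong[of \<alpha> F "jet m F" A a] by simp
  next
    case False
    then show ?thesis
      using mcoeff_homological_cong[of \<alpha> "jet m F" 0 A a] by (simp add: homological_0)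
  qed
qed

lemma homological_identity: "homological A (linear_series (mat 1)) = 0"
proof -
  have "mat_act A (linear_series (mat 1)) = linear_series A"
    by (metis fcomp_linear_series_left fcomp_identity_right no_const_linear_series)
  then show ?thesis
    by (simp add: homological_def fcomp_identity_left no_const_linear_series)
qed


section \<open>Solving the conjugacy equation order by order\<close>

definition residual :: "complex ^ 'n ^ 'n \<Rightarrow> 'n::finite mfps ^ 'n \<Rightarrow> 'n mfps ^ 'n \<Rightarrow> 'n mfps ^ 'n"
  where "residual A f h = fcomp h f - mat_act A h"

lemma residual_add: "residual A f (g + h) = residual A f g + residual A f h"
  by (simp add: residual_def fcomp_add mat_act_add)

lemma mcoeff_residual_cong:
  assumes "\<And>a \<beta>. mdeg \<beta> \<le> mdeg \<alpha> \<Longrightarrow> mcoeff (g $ a) \<beta> = mcoeff (h $ a) \<beta>"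
  shows "mcoeff (residual A f g $ a) \<alpha> = mcoeff (residual A f h $ a) \<alpha>"
  using mcoeff_fcomp_cong[of \<alpha> g a h f] assms by (simp add: residual_def mcoeff_mat_act)

lemma mcoeff_residual_leading:
  assumes "no_const f" "linear_part f = A"
    and "\<And>a \<beta>. mdeg \<beta> < mdeg \<alpha> \<Longrightarrow> mcoeff (h $ a) \<beta> = 0"
  shows "mcoeff (residual A f h $ a) \<alpha> = - mcoeff (homological A h $ a) \<alpha>"
  using mcoeff_fcomp_leading[of f "linear_series A" \<alpha> h a] assms
  by (simp add: residual_def homological_def no_const_linear_series)

text \<open>
  Because \<open>f\<close> is linearizable, no solution up to order \<open>m\<close> meets an obstruction at the next
  order. Comparing such a \<open>P\<close> with an actual linearization \<open>h\<close>, the \<open>m\<close>-jet \<open>k\<close> of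
  \<open>P \<circ> h\<^sup>-\<^sup>1\<close> commutes with \<open>A\<close>: it does so up to order \<open>m\<close>, and the equation for
  commutation with a linear map is homogeneous. Hence \<open>k \<circ> h\<close> is again a linearization, and it
  has the same \<open>m\<close>-jet as \<open>P\<close>.
\<close>

lemma residual_in_range_homological:
  fixes f P :: "'n::finite mfps ^ 'n"
  assumes A: "invertible A" and f: "f \<in> carrier formal_diff" "linear_part f = A"
    and h: "h \<in> formal_linearizations A f"
    and P: "P \<in> formal_diff0"
    and res: "\<And>a \<alpha>. mdeg \<alpha> \<le> m \<Longrightarrow> mcoeff (residual A f P $ a) \<alpha> = 0"
  obtains \<phi> where "hom_part (Suc m) \<phi> = \<phi>" "homological A \<phi> = hom_part (Suc m) (residual A f P)"
proof -
  let ?i = "inv\<^bsub>formal_diff\<^esub> h"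
  have h0: "h \<in> formal_diff0" and hf: "fcomp h f = mat_act A h"
    using h formal_linearizations_iff[OF f(1) A] by auto
  have hU: "h \<in> Units formal_diff" "no_const h"
    using h0 formal_diff0_Units by (auto simp: formal_diff0_iff)
  have i: "?i \<in> carrier formal_diff"
    using hU by simp
  have A': "linear_series A \<in> carrier formal_diff"
    using A by (simp add: carrier_formal_diff no_const_linear_series)
  have nc: "no_const ?i" "no_const f" "no_const P"
    using i f P by (auto simp: carrier_formal_diff formal_diff0_iff)
  have hf': "h \<otimes>\<^bsub>formal_diff\<^esub> f = linear_series A \<otimes>\<^bsub>formal_diff\<^esub> h"
    using hf hU by (simp add: fcomp_linear_series_left)
  then have fi: "fcomp f ?i = fcomp ?i (linear_series A)"
    using formal_diff.conjugation_iff(3)[OF hU(1) f(1) A'] by simp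
  have ih: "fcomp ?i h = linear_series (mat 1)"
    using formal_diff.Units_l_inv[OF hU(1)] by simp
  define k' where "k' = fcomp P ?i"
  define k where "k = jet m k'"
  have "homological A k' = - fcomp (residual A f P) ?i"
    using nc by (simp add: homological_def k'_def residual_def fcomp_diff fcomp_assoc
        no_const_linear_series fi mat_act_fcomp)
  then have "mcoeff (homological A k' $ a) \<alpha> = 0" if "mdeg \<alpha> \<le> m" for a \<alpha>
    using that mcoeff_fcomp_eq_0[of \<alpha> "residual A f P" a ?i] res by (simp add: uminus_mfps_def)
  then have "homological A k = 0"
    unfolding k_def by (auto intro!: series_eqI simp flip: jet_homological)
  then have kA: "fcomp k (linear_series A) = mat_act A k"
    by (simp add: homological_def)
  define h' where "h' = fcomp k h"
  have "residual A f h' = 0"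
  proof -
    have "fcomp h' f = fcomp k (fcomp (linear_series A) h)"
      using hU nc by (simp add: h'_def fcomp_assoc hf fcomp_linear_series_left)
    also have "\<dots> = mat_act A h'"
      using hU by (simp add: h'_def kA mat_act_fcomp no_const_linear_series flip: fcomp_assoc)
    finally show ?thesis
      by (simp add: residual_def)
  qed
  have same_jet: "mcoeff (h' $ a) \<alpha> = mcoeff (P $ a) \<alpha>" if "mdeg \<alpha> \<le> m" for a \<alpha>
  proof -
    have "mcoeff (h' $ a) \<alpha> = mcoeff (fcomp k' h $ a) \<alpha>"
      unfolding h'_def by (rule mcoeff_fcomp_cong) (use that in \<open>simp add: k_def\<close>)
    also have "fcomp k' h = P"
      using nc hU by (simp add: k'_def fcomp_assoc ih fcomp_identity_right)
    finally show ?thesis .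
  qed
  define \<psi> where "\<psi> = h' - P"
  have "residual A f P + residual A f \<psi> = 0"
    using \<open>residual A f h' = 0\<close> by (simp add: \<psi>_def flip: residual_add)
  then have sum0: "mcoeff (residual A f P $ a) \<alpha> + mcoeff (residual A f \<psi> $ a) \<alpha> = 0" for a \<alpha>
    by (metis mcoeff_0 mcoeff_add vector_add_component zero_index)
  have "homological A (hom_part (Suc m) \<psi>) = hom_part (Suc m) (residual A f P)"
  proof (rule series_eqI)
    fix a and \<alpha> :: "'n \<Rightarrow> nat"
    have "mcoeff (residual A f \<psi> $ a) \<alpha> = - mcoeff (homological A \<psi> $ a) \<alpha>" if "mdeg \<alpha> = Suc m"
      using that nc f(2) by (intro mcoeff_residual_leading) (auto simp: \<psi>_def same_jet)
    then show "mcoeff (homological A (hom_part (Suc m) \<psi>) $ a) \<alpha> =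
        mcoeff (hom_part (Suc m) (residual A f P) $ a) \<alpha>"
      using sum0[of a \<alpha>] by (auto simp: neg_eq_iff_add_eq_0 simp flip: hom_part_homological)
  qed
  then show ?thesis
    using that[of "hom_part (Suc m) \<psi>"] by (simp add: hom_part_hom_part)
qed

text \<open>
  The linear map \<open>g m\<close> selects a solution of \<open>homological A \<phi> = v\<close> among the homogeneous \<open>\<phi>\<close>
  of degree \<open>m\<close> whenever there is one. Linearity of this choice is what turns a residual
  polynomial in parameters into a correction polynomial in them.
\<close>

definition graded_right_inverse ::
    "complex ^ 'n ^ 'n \<Rightarrow> (nat \<Rightarrow> 'n::finite mfps ^ 'n \<Rightarrow> 'n mfps ^ 'n) \<Rightarrow> bool"
  where "graded_right_inverse A g \<longleftrightarrow>
    (\<forall>m. Vector_Spaces.linear cscale cscale (g m) \<and> (\<forall>v. hom_part m (g m v) = g m v) \<and>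
      (\<forall>\<phi>. hom_part m \<phi> = \<phi> \<longrightarrow> homological A (g m (homological A \<phi>)) = homological A \<phi>))"

lemma hom_part_add: "hom_part m (F + G) = hom_part m F + hom_part m G"
  by (rule series_eqI) simp

lemma hom_part_cscale: "hom_part m (cscale c F) = cscale c (hom_part m F)"
  by (rule series_eqI) simp

lemma graded_right_inverse_exists:
  obtains g where "graded_right_inverse A g"
proof -
  have "series.vs1.subspace {\<phi> :: 'a mfps ^ 'a. hom_part m \<phi> = \<phi>}" for m
    by (intro series.vs1.subspaceI)
      (auto simp: hom_part_add hom_part_cscale intro!: series_eqI)
  from series.linear_exists_right_inverse_on[OF linear_homological[of A] this]
  have "\<forall>m. \<exists>g. Vector_Spaces.linear cscale cscale g \<and> (\<forall>v. hom_part m (g v) = g v) \<and>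
      (\<forall>\<phi>. hom_part m \<phi> = \<phi> \<longrightarrow> homological A (g (homological A \<phi>)) = homological A \<phi>)"
    by (intro allI) (metis (mono_tags, lifting) imageI image_subset_iff mem_Collect_eq UNIV_I)
  then show ?thesis
    using that unfolding graded_right_inverse_def by metis
qed

text \<open>
  The identity solves the equation up to order \<open>1\<close>, so stage \<open>n\<close> is meant to solve it up to order
  \<open>n + 1\<close>, and the next correction has degree \<open>n + 2\<close>.
\<close>

primrec linearization_approx :: "(nat \<Rightarrow> 'n::finite mfps ^ 'n \<Rightarrow> 'n mfps ^ 'n) \<Rightarrow>
    complex ^ 'n ^ 'n \<Rightarrow> 'n mfps ^ 'n \<Rightarrow> nat \<Rightarrow> 'n mfps ^ 'n"
  where
    "linearization_approx g A f 0 = linear_series (mat 1)"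
  | "linearization_approx g A f (Suc n) = linearization_approx g A f n +
       g (n + 2) (hom_part (n + 2) (residual A f (linearization_approx g A f n)))"

definition linearization_limit :: "(nat \<Rightarrow> 'n::finite mfps ^ 'n \<Rightarrow> 'n mfps ^ 'n) \<Rightarrow>
    complex ^ 'n ^ 'n \<Rightarrow> 'n mfps ^ 'n \<Rightarrow> 'n mfps ^ 'n"
  where "linearization_limit g A f =
    (\<chi> a. Abs_mfps (\<lambda>\<alpha>. mcoeff (linearization_approx g A f (mdeg \<alpha>) $ a) \<alpha>))"

text \<open>
  A correction \<open>\<phi>\<close> of degree \<open>n + 2\<close> leaves the residual unchanged in lower orders and subtracts
  \<^term>\<open>homological A \<phi>\<close> from it in order \<open>n + 2\<close>.
\<close>

lemma linearization_approx_correct: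
  fixes f :: "'n::finite mfps ^ 'n"
  assumes g: "graded_right_inverse A g"
    and A: "invertible A" and f: "f \<in> carrier formal_diff" "linear_part f = A"
    and h: "h \<in> formal_linearizations A f"
  shows "linearization_approx g A f n \<in> formal_diff0 \<and>
    (\<forall>a \<alpha>. mdeg \<alpha> \<le> Suc n \<longrightarrow> mcoeff (residual A f (linearization_approx g A f n) $ a) \<alpha> = 0)"
proof (induction n)
  case 0
  have "no_const f"
    using f by (simp add: carrier_formal_diff)
  then have "residual A f (linear_series (mat 1)) = f - linear_series A"
    by (metis residual_def fcomp_identity_left fcomp_linear_series_left fcomp_identity_right
        no_const_linear_series)
  moreover have "mcoeff (f $ a) \<alpha> = mcoeff (linear_series A $ a) \<alpha>" if "mdeg \<alpha> < 2" for a \<alpha>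
    using that
  proof (cases rule: mdeg_less_2_cases)
    case 1
    then show ?thesis
      using \<open>no_const f\<close> by (simp add: no_const_def mcoeff_linear_series_eq_0)
  next
    case (2 j)
    then show ?thesis
      using f(2) by (auto simp: mcoeff_linear_series linear_part_def)
  qed
  ultimately show ?case
    by (simp add: formal_diff0_iff no_const_linear_series)
next
  case (Suc n)
  define P where "P = linearization_approx g A f n"
  define \<phi> where "\<phi> = g (n + 2) (hom_part (n + 2) (residual A f P))"
  have P: "P \<in> formal_diff0"
    and res: "\<And>a \<alpha>. mdeg \<alpha> \<le> Suc n \<Longrightarrow> mcoeff (residual A f P $ a) \<alpha> = 0"
    using Suc by (auto simp: P_def)
  have approx: "linearization_approx g A f (Suc n) = P + \<phi>"
    by (simp add: P_def \<phi>_def)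
  obtain \<phi>' where "hom_part (n + 2) \<phi>' = \<phi>'" "homological A \<phi>' = hom_part (n + 2) (residual A f P)"
    using residual_in_range_homological[OF A f h P res] by auto
  then have \<phi>: "homological A \<phi> = hom_part (n + 2) (residual A f P)"
    using g unfolding graded_right_inverse_def \<phi>_def by metis
  have "hom_part (n + 2) \<phi> = \<phi>"
    using g by (simp add: graded_right_inverse_def \<phi>_def)
  then have low: "mcoeff (\<phi> $ a) \<beta> = 0" if "mdeg \<beta> < n + 2" for a \<beta>
    using that mcoeff_hom_part[of "n + 2" \<phi> a \<beta>] by simp
  have "P + \<phi> \<in> formal_diff0"
    using P low by (simp add: formal_diff0_iff_low_order)
  moreover have "mcoeff (residual A f (P + \<phi>) $ a) \<alpha> = 0" if "mdeg \<alpha> \<le> n + 2" for a \<alpha>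
  proof -
    have "mcoeff (residual A f \<phi> $ a) \<alpha> = - mcoeff (homological A \<phi> $ a) \<alpha>"
      using f that by (intro mcoeff_residual_leading) (auto simp: carrier_formal_diff low)
    then show ?thesis
      using res[of \<alpha> a] that by (auto simp: residual_add \<phi>)
  qed
  ultimately show ?case
    unfolding approx by simp
qed

lemma linearization_approx_stable:
  assumes g: "graded_right_inverse A g" and "mdeg \<alpha> \<le> n"
  shows "mcoeff (linearization_approx g A f n $ a) \<alpha> = mcoeff (linearization_limit g A f $ a) \<alpha>"
  using assms(2)
proof (induction n rule: dec_induct)
  case (step n)
  define v where "v = hom_part (n + 2) (residual A f (linearization_approx g A f n))"
  have "g (n + 2) v = hom_part (n + 2) (g (n + 2) v)"
    using g by (simp add: graded_right_inverse_def)
  then have "mcoeff (g (n + 2) v $ a) \<alpha> = 0"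
    using step.hyps mcoeff_hom_part[of "n + 2" "g (n + 2) v" a \<alpha>] by simp
  with step.IH show ?case
    by (simp add: v_def)
qed (simp add: linearization_limit_def)

lemma linearization_limit_in_formal_linearizations:
  fixes f :: "'n::finite mfps ^ 'n"
  assumes g: "graded_right_inverse A g"
    and A: "invertible A" and f: "f \<in> carrier formal_diff" "linear_part f = A"
    and h: "h \<in> formal_linearizations A f"
  shows "linearization_limit g A f \<in> formal_linearizations A f"
proof -
  let ?P = "linearization_approx g A f" and ?h = "linearization_limit g A f"
  note correct = linearization_approx_correct[OF assms]
  have "?h \<in> formal_diff0"
    unfolding formal_diff0_iff_low_order
  proof (intro allI impI)
    fix a and \<alpha> :: "'n \<Rightarrow> nat"
    assume "mdeg \<alpha> < 2"
    moreover have "mcoeff (?h $ a) \<alpha> = mcoeff (?P (mdeg \<alpha>) $ a) \<alpha>"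
      by (simp add: linearization_limit_def)
    ultimately show "mcoeff (?h $ a) \<alpha> = mcoeff (linear_series (mat 1) $ a) \<alpha>"
      using correct[of "mdeg \<alpha>"] by (simp add: formal_diff0_iff_low_order)
  qed
  moreover have "residual A f ?h = 0"
  proof (rule series_eqI)
    fix a and \<alpha> :: "'n \<Rightarrow> nat"
    have "mcoeff (residual A f ?h $ a) \<alpha> = mcoeff (residual A f (?P (mdeg \<alpha>)) $ a) \<alpha>"
      by (rule mcoeff_residual_cong) (simp add: linearization_approx_stable[OF g])
    then show "mcoeff (residual A f ?h $ a) \<alpha> = mcoeff ((0 :: 'n mfps ^ 'n) $ a) \<alpha>"
      using correct[of "mdeg \<alpha>"] by simp
  qed
  ultimately show ?thesis
    using f A by (simp add: formal_linearizations_iff residual_def)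
qed


section \<open>Polynomial functions\<close>

lemma poly_fun_monomial:
  fixes i :: "'k::finite \<Rightarrow> nat"
  assumes "mdeg i \<le> p" "size J \<le> q"
  shows "poly_fun S p q (\<lambda>t s. c * monom_eval t i * (\<Prod>l\<in>#J. s l))"
  unfolding poly_fun_def
  by (rule exI[of _ "{(i, J)}"], rule exI[of _ "\<lambda>_ _. c"]) (simp add: assms)

lemma poly_fun_0: "poly_fun S p q (\<lambda>(t :: complex ^ 'k::finite) s. 0)"
  unfolding poly_fun_def by (rule exI[of _ "{}"]) simp

lemma poly_fun_add:
  fixes f g :: "complex ^ 'k::finite \<Rightarrow> (nat \<Rightarrow> complex) \<Rightarrow> complex"
  assumes "poly_fun S p q f" "poly_fun S p q g"
  shows "poly_fun S p q (\<lambda>t s. f t s + g t s)"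
proof -
  let ?m = "\<lambda>t s x. monom_eval t (fst x) * (\<Prod>l\<in>#snd x. s l)"
  obtain M c where M: "finite M" "\<forall>(i, J)\<in>M. mdeg i \<le> p \<and> size J \<le> q"
    and f: "\<And>t s. s \<in> S \<Longrightarrow> f t s = (\<Sum>x\<in>M. c (fst x) (snd x) * ?m t s x)"
    using assms(1) unfolding poly_fun_def by (auto simp: case_prod_unfold mult.assoc)
  obtain M' c' where M': "finite M'" "\<forall>(i, J)\<in>M'. mdeg i \<le> p \<and> size J \<le> q"
    and g: "\<And>t s. s \<in> S \<Longrightarrow> g t s = (\<Sum>x\<in>M'. c' (fst x) (snd x) * ?m t s x)"
    using assms(2) unfolding poly_fun_def by (auto simp: case_prod_unfold mult.assoc)
  define d where "d i J = (if (i, J) \<in> M then c i J else 0) + (if (i, J) \<in> M' then c' i J else 0)" for i J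
  have "f t s + g t s = (\<Sum>x\<in>M \<union> M'. d (fst x) (snd x) * ?m t s x)" if "s \<in> S" for t s
  proof -
    have "(\<Sum>x\<in>M. c (fst x) (snd x) * ?m t s x) =
        (\<Sum>x\<in>M \<union> M'. (if x \<in> M then c (fst x) (snd x) else 0) * ?m t s x)"
      using M(1) M'(1) by (intro sum.mono_neutral_cong_left) auto
    moreover have "(\<Sum>x\<in>M'. c' (fst x) (snd x) * ?m t s x) =
        (\<Sum>x\<in>M \<union> M'. (if x \<in> M' then c' (fst x) (snd x) else 0) * ?m t s x)"
      using M(1) M'(1) by (intro sum.mono_neutral_cong_left) auto
    ultimately show ?thesis
      by (simp only: f[OF that] g[OF that] d_def prod.collapse distrib_right sum.distrib)
  qed
  then show ?thesis
    unfolding poly_fun_def using M M'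
    by (intro exI[of _ "M \<union> M'"] exI[of _ d]) (auto simp: case_prod_unfold mult.assoc)
qed

lemma poly_fun_sum:
  fixes f :: "'x \<Rightarrow> complex ^ 'k::finite \<Rightarrow> (nat \<Rightarrow> complex) \<Rightarrow> complex"
  assumes "\<And>x. x \<in> X \<Longrightarrow> poly_fun S p q (f x)"
  shows "poly_fun S p q (\<lambda>t s. \<Sum>x\<in>X. f x t s)"
  using assms
proof (induction X rule: infinite_finite_induct)
  case (insert x X)
  then show ?case
    using poly_fun_add[of S p q "f x" "\<lambda>t s. \<Sum>x\<in>X. f x t s"] by simp
qed (auto simp: poly_fun_0)

lemma poly_fun_cong:
  fixes f g :: "complex ^ 'k::finite \<Rightarrow> (nat \<Rightarrow> complex) \<Rightarrow> complex"
  assumes "poly_fun S p q g" "\<And>t s. s \<in> S \<Longrightarrow> f t s = g t s"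
  shows "poly_fun S p q f"
  using assms unfolding poly_fun_def by simp

lemma poly_fun_mono:
  fixes f :: "complex ^ 'k::finite \<Rightarrow> (nat \<Rightarrow> complex) \<Rightarrow> complex"
  assumes "poly_fun S p q f" "p \<le> p'" "q \<le> q'"
  shows "poly_fun S p' q' f"
  using assms unfolding poly_fun_def by (fastforce intro: order_trans)

lemma monom_eval_add: "monom_eval t (\<lambda>a. i a + j a) = monom_eval t i * monom_eval t j"
  by (simp add: monom_eval_def power_add prod.distrib)

lemma poly_fun_mult:
  fixes f g :: "complex ^ 'k::finite \<Rightarrow> (nat \<Rightarrow> complex) \<Rightarrow> complex"
  assumes "poly_fun S p q f" "poly_fun S p' q' g"
  shows "poly_fun S (p + p') (q + q') (\<lambda>t s. f t s * g t s)"
proof -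
  obtain M c where M: "finite M" "\<forall>(i, J)\<in>M. mdeg i \<le> p \<and> size J \<le> q"
    and f: "\<And>t s. s \<in> S \<Longrightarrow>
      f t s = (\<Sum>x\<in>M. c (fst x) (snd x) * monom_eval t (fst x) * (\<Prod>l\<in>#snd x. s l))"
    using assms(1) unfolding poly_fun_def by (auto simp: case_prod_unfold)
  obtain M' c' where M': "finite M'" "\<forall>(i, J)\<in>M'. mdeg i \<le> p' \<and> size J \<le> q'"
    and g: "\<And>t s. s \<in> S \<Longrightarrow>
      g t s = (\<Sum>x\<in>M'. c' (fst x) (snd x) * monom_eval t (fst x) * (\<Prod>l\<in>#snd x. s l))"
    using assms(2) unfolding poly_fun_def by (auto simp: case_prod_unfold)
  have "poly_fun S (p + p') (q + q') (\<lambda>t s. \<Sum>x\<in>M. \<Sum>y\<in>M'. c (fst x) (snd x) * c' (fst y) (snd y) *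
      monom_eval t (\<lambda>a. fst x a + fst y a) * (\<Prod>l\<in>#snd x + snd y. s l))"
    using M M' by (intro poly_fun_sum poly_fun_monomial) (fastforce simp: mdeg_add intro: add_mono)+
  then show ?thesis
  proof (rule poly_fun_cong)
    fix t :: "complex ^ 'k" and s
    assume "s \<in> S"
    then show "f t s * g t s = (\<Sum>x\<in>M. \<Sum>y\<in>M'. c (fst x) (snd x) * c' (fst y) (snd y) *
        monom_eval t (\<lambda>a. fst x a + fst y a) * (\<Prod>l\<in>#snd x + snd y. s l))"
      unfolding f[OF \<open>s \<in> S\<close>] g[OF \<open>s \<in> S\<close>] sum_product
      by (intro sum.cong refl) (simp add: monom_eval_add mult_ac)
  qed
qed

lemma poly_fun_const: "poly_fun S p q (\<lambda>(t :: complex ^ 'k::finite) s. c)"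
  using poly_fun_monomial[of "\<lambda>_ :: 'k. 0" p "{#}" q S c] by (simp add: monom_eval_def)

lemma poly_fun_cmult:
  fixes f :: "complex ^ 'k::finite \<Rightarrow> (nat \<Rightarrow> complex) \<Rightarrow> complex"
  shows "poly_fun S p q f \<Longrightarrow> poly_fun S p q (\<lambda>t s. c * f t s)"
  using poly_fun_mult[OF poly_fun_const[of S 0 0 c]] by simp

lemma poly_fun_diff:
  fixes f g :: "complex ^ 'k::finite \<Rightarrow> (nat \<Rightarrow> complex) \<Rightarrow> complex"
  assumes "poly_fun S p q f" "poly_fun S p q g"
  shows "poly_fun S p q (\<lambda>t s. f t s - g t s)"
  using poly_fun_add[OF assms(1) poly_fun_cmult[OF assms(2), of "-1"]] by simp

lemma poly_fun_coordinate: "poly_fun S p 1 (\<lambda>(t :: complex ^ 'k::finite) s. s l)"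
  using poly_fun_monomial[of "\<lambda>_ :: 'k. 0" p "{#l#}" 1 S 1] by (simp add: monom_eval_def)


section \<open>Polynomial dependence of the linearization on the parameter\<close>

text \<open>
  If the degree in \<open>t\<close> of every coefficient of \<open>G\<close> of order \<open>m\<close> is at most \<open>d (m - r)\<close>, then
  passing to a product of powers adds up the shifts \<open>r\<close>. Two values of \<open>r\<close> matter. For \<open>r = 1\<close>
  the bound is \<open>d (\<bar>\<alpha>\<bar> - \<bar>\<beta>\<bar>)\<close>, so that substituting \<open>G\<close> into a series whose coefficient at
  \<open>\<beta>\<close> has degree at most \<open>d \<bar>\<beta>\<bar>\<close> gives a series of the same kind; for \<open>r = 0\<close> it is
  \<open>d \<bar>\<alpha>\<bar>\<close>, which suffices when the outer series does not depend on \<open>t\<close>.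
\<close>

lemma poly_fun_mpow:
  fixes G :: "complex ^ 'k::finite \<Rightarrow> 'n::finite mfps ^ 'n"
  assumes vanish: "\<And>t j \<alpha>. mdeg \<alpha> < r \<Longrightarrow> mcoeff (G t $ j) \<alpha> = 0"
    and poly: "\<And>j \<alpha>. poly_fun S (d * (mdeg \<alpha> - r)) 0 (\<lambda>t s. mcoeff (G t $ j) \<alpha>)"
  shows "poly_fun S (d * (mdeg \<alpha> - r * mdeg \<beta>)) 0 (\<lambda>t s. mcoeff (mpow (G t) \<beta>) \<alpha>)"
proof -
  define Q where "Q w u \<longleftrightarrow> (\<forall>\<alpha>. (\<forall>t. mdeg \<alpha> < r * w \<longrightarrow> mcoeff (u t) \<alpha> = 0) \<and>
      poly_fun S (d * (mdeg \<alpha> - r * w)) 0 (\<lambda>t s. mcoeff (u t) \<alpha>))"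
    for w and u :: "complex ^ 'k \<Rightarrow> 'n mfps"
  have "Q (mdeg \<beta>) (\<lambda>t. mpow (G t) \<beta>)"
  proof (rule mpow_graded)
    show "Q (v + w) (\<lambda>t. a t * b t)" if Q: "Q v a" "Q w b" for v w a b
    proof -
      have low: "mcoeff (a t) (fst p) * mcoeff (b t) (snd p) = 0"
        if "mdeg (fst p) < r * v \<or> mdeg (snd p) < r * w" for t p
        using Q that by (auto simp: Q_def)
      have "mcoeff (a t * b t) \<alpha> = 0" if "mdeg \<alpha> < r * (v + w)" for t \<alpha>
        unfolding mcoeff_mult
      proof (intro sum.neutral ballI low)
        fix p
        assume "p \<in> index_splits \<alpha>"
        then show "mdeg (fst p) < r * v \<or> mdeg (snd p) < r * w"
          using mdeg_index_splits[of p \<alpha>] that by (auto simp: distrib_left)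
      qed
      moreover have "poly_fun S (d * (mdeg \<alpha> - r * (v + w))) 0 (\<lambda>t s. mcoeff (a t * b t) \<alpha>)" for \<alpha>
        unfolding mcoeff_mult
      proof (rule poly_fun_sum)
        fix p
        assume p: "p \<in> index_splits \<alpha>"
        show "poly_fun S (d * (mdeg \<alpha> - r * (v + w))) 0
            (\<lambda>t s. mcoeff (a t) (fst p) * mcoeff (b t) (snd p))"
        proof (cases "mdeg (fst p) < r * v \<or> mdeg (snd p) < r * w")
          case True
          then show ?thesis
            by (simp only: low poly_fun_0)
        next
          case False
          then have "mdeg \<alpha> - r * (v + w) = (mdeg (fst p) - r * v) + (mdeg (snd p) - r * w)"
            using mdeg_index_splits[OF p] by (simp add: distrib_left)
          then have deg: "d * (mdeg \<alpha> - r * (v + w)) =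
              d * (mdeg (fst p) - r * v) + d * (mdeg (snd p) - r * w)"
            by (simp add: distrib_left)
          have "poly_fun S (d * (mdeg (fst p) - r * v)) 0 (\<lambda>t s. mcoeff (a t) (fst p))"
            "poly_fun S (d * (mdeg (snd p) - r * w)) 0 (\<lambda>t s. mcoeff (b t) (snd p))"
            using Q by (simp_all add: Q_def)
          from poly_fun_mult[OF this] show ?thesis
            unfolding deg by simp
        qed
      qed
      ultimately show ?thesis
        unfolding Q_def by blast
    qed
  qed (use assms in \<open>auto simp: Q_def poly_fun_const\<close>)
  then show ?thesis
    by (simp add: Q_def)
qed

definition basis_series :: "'n \<Rightarrow> ('n \<Rightarrow> nat) \<Rightarrow> 'n::finite mfps ^ 'n"
  where "basis_series a \<alpha> = (\<chi> b. Abs_mfps (\<lambda>\<beta>. if b = a \<and> \<beta> = \<alpha> then 1 else 0))"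

lemma finite_mdeg_eq: "finite {\<alpha> :: 'n::finite \<Rightarrow> nat. mdeg \<alpha> = m}"
  by (rule finite_subset[OF _ finite_mdeg_le[of m]]) auto

lemma hom_part_expansion:
  "hom_part m v = (\<Sum>x\<in>UNIV \<times> {\<alpha>. mdeg \<alpha> = m}.
     cscale (mcoeff (v $ fst x) (snd x)) (basis_series (fst x) (snd x)))"
proof (rule series_eqI)
  fix b and \<beta> :: "'a \<Rightarrow> nat"
  let ?X = "(UNIV :: 'a set) \<times> {\<alpha> :: 'a \<Rightarrow> nat. mdeg \<alpha> = m}"
  have "finite ?X"
    by (simp add: finite_mdeg_eq)
  have "mcoeff ((\<Sum>x\<in>?X. cscale (mcoeff (v $ fst x) (snd x)) (basis_series (fst x) (snd x))) $ b) \<beta> =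
      (\<Sum>x\<in>?X. if x = (b, \<beta>) then mcoeff (v $ b) \<beta> else 0)"
    unfolding sum_component mcoeff_sum
    by (rule sum.cong) (auto simp: basis_series_def)
  also have "\<dots> = mcoeff (hom_part m v $ b) \<beta>"
    using \<open>finite ?X\<close> by simp
  finally show "mcoeff (hom_part m v $ b) \<beta> = mcoeff ((\<Sum>x\<in>?X.
      cscale (mcoeff (v $ fst x) (snd x)) (basis_series (fst x) (snd x))) $ b) \<beta>" ..
qed

text \<open>
  A homogeneous part has finitely many coefficients, so a linear map acts on it by a finite matrix
  of constants.
\<close>

lemma poly_fun_linear_image:
  fixes v :: "complex ^ 'k::finite \<Rightarrow> 'n::finite mfps ^ 'n" and g :: "'n mfps ^ 'n \<Rightarrow> 'n mfps ^ 'n"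
  assumes g: "Vector_Spaces.linear cscale cscale g"
    and v: "\<And>a \<alpha>. mdeg \<alpha> = m \<Longrightarrow> poly_fun S p q (\<lambda>t s. mcoeff (v t $ a) \<alpha>)"
  shows "poly_fun S p q (\<lambda>t s. mcoeff (g (hom_part m (v t)) $ b) \<beta>)"
proof -
  have "mcoeff (g (hom_part m (v t)) $ b) \<beta> = (\<Sum>x\<in>UNIV \<times> {\<alpha>. mdeg \<alpha> = m}.
      mcoeff (g (basis_series (fst x) (snd x)) $ b) \<beta> * mcoeff (v t $ fst x) (snd x))" for t
    unfolding hom_part_expansion series.linear_sum[OF g] series.linear_scale[OF g]
    by (simp add: sum_component mult.commute)
  moreover have "poly_fun S p q (\<lambda>t s. \<Sum>x\<in>UNIV \<times> {\<alpha>. mdeg \<alpha> = m}.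
      mcoeff (g (basis_series (fst x) (snd x)) $ b) \<beta> * mcoeff (v t $ fst x) (snd x))"
    by (intro poly_fun_sum poly_fun_cmult v) auto
  ultimately show ?thesis
    by simp
qed

text \<open>
  The right inverse \<open>g\<close> depends on \<open>A\<close> alone and not on \<open>t\<close>: this is why the correction of
  degree \<open>m\<close>, chosen as \<open>g m\<close> of the residual, is polynomial in \<open>t\<close>. Its degree is that of
  the residual, and there the terms \<open>P\<^sub>\<beta> f\<^sup>\<beta>\<close> of order \<open>m\<close> have degree at most
  \<open>d \<bar>\<beta>\<bar> + d (m - \<bar>\<beta>\<bar>)\<close>.
\<close>

lemma poly_fun_linearization_approx:
  fixes f :: "complex ^ 'k::finite \<Rightarrow> 'n::finite mfps ^ 'n"
  assumes g: "graded_right_inverse A g"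
    and f: "\<And>t. no_const (f t)"
      "\<And>j \<alpha>. poly_fun S (d * (mdeg \<alpha> - 1)) 0 (\<lambda>t s. mcoeff (f t $ j) \<alpha>)"
  shows "poly_fun S (d * mdeg \<alpha>) 0 (\<lambda>t s. mcoeff (linearization_approx g A (f t) n $ a) \<alpha>)"
proof (induction n arbitrary: a \<alpha>)
  case 0
  show ?case
    by (simp add: poly_fun_const)
next
  case (Suc n)
  let ?P = "\<lambda>t. linearization_approx g A (f t) n"
  have f_pow: "poly_fun S (d * (mdeg \<alpha> - mdeg \<beta>)) 0 (\<lambda>t s. mcoeff (mpow (f t) \<beta>) \<alpha>)" for \<alpha> \<beta>
    using poly_fun_mpow[of 1 f S d \<alpha> \<beta>] f by (simp add: no_const_def)
  have comp: "poly_fun S (d * mdeg \<alpha>) 0 (\<lambda>t s. mcoeff (fcomp (?P t) (f t) $ a) \<alpha>)" for a \<alpha>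
    unfolding mcoeff_fcomp
  proof (rule poly_fun_sum)
    fix \<beta> :: "'n \<Rightarrow> nat"
    assume "\<beta> \<in> {\<beta>. mdeg \<beta> \<le> mdeg \<alpha>}"
    then have "d * mdeg \<beta> + d * (mdeg \<alpha> - mdeg \<beta>) = d * mdeg \<alpha>"
      by (simp flip: distrib_left)
    then show "poly_fun S (d * mdeg \<alpha>) 0 (\<lambda>t s. mcoeff (?P t $ a) \<beta> * mcoeff (mpow (f t) \<beta>) \<alpha>)"
      using poly_fun_mult[OF Suc.IH[of \<beta> a] f_pow[of \<alpha> \<beta>]] by simp
  qed
  have res: "poly_fun S (d * mdeg \<alpha>) 0 (\<lambda>t s. mcoeff (residual A (f t) (?P t) $ a) \<alpha>)" for a \<alpha>
    unfolding residual_def vector_minus_component mcoeff_diff mcoeff_mat_act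
    by (intro poly_fun_diff comp poly_fun_sum poly_fun_cmult Suc.IH)
  let ?v = "\<lambda>t. g (n + 2) (hom_part (n + 2) (residual A (f t) (?P t)))"
  have "poly_fun S (d * mdeg \<alpha>) 0 (\<lambda>t s. mcoeff (?v t $ a) \<alpha>)"
  proof (cases "mdeg \<alpha> = n + 2")
    case True
    have lin: "Vector_Spaces.linear cscale cscale (g (n + 2))"
      using g by (simp add: graded_right_inverse_def)
    show ?thesis
    proof (rule poly_fun_linear_image[OF lin])
      show "poly_fun S (d * mdeg \<alpha>) 0 (\<lambda>t s. mcoeff (residual A (f t) (?P t) $ b) \<beta>)"
        if "mdeg \<beta> = n + 2" for b \<beta>
        using res[of \<beta> b] that True by simp
    qed
  next
    case False
    have "hom_part (n + 2) (?v t) = ?v t" for t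
      using g by (simp add: graded_right_inverse_def)
    then have "mcoeff (?v t $ a) \<alpha> = 0" for t
      using mcoeff_hom_part[of "n + 2" "?v t" a \<alpha>] False by simp
    then show ?thesis
      by (simp only: poly_fun_0)
  qed
  with Suc.IH[of \<alpha> a] show ?case
    using poly_fun_add by fastforce
qed

corollary poly_fun_linearization_limit:
  fixes f :: "complex ^ 'k::finite \<Rightarrow> 'n::finite mfps ^ 'n"
  assumes "graded_right_inverse A g" "\<And>t. no_const (f t)"
    "\<And>j \<alpha>. poly_fun S (d * (mdeg \<alpha> - 1)) 0 (\<lambda>t s. mcoeff (f t $ j) \<alpha>)"
  shows "poly_fun S (d * mdeg \<alpha>) 0 (\<lambda>t s. mcoeff (linearization_limit g A (f t) $ a) \<alpha>)"
  using poly_fun_linearization_approx[OF assms, of \<alpha> "mdeg \<alpha>" a]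
  by (simp add: linearization_limit_def)


section \<open>Parametrizing the centralizer\<close>

lemma coords_add_identity [simp]: "coords (linear_series (mat 1) + F) = F"
  by (simp add: coords_def)

text \<open>
  Homogeneous elements of degree \<open>m\<close> of the linear space corresponding to \<^term>\<open>Cent A\<close>,
  which starts in degree \<open>2\<close>.
\<close>

definition cent_part :: "complex ^ 'n ^ 'n \<Rightarrow> nat \<Rightarrow> ('n::finite mfps ^ 'n) set"
  where "cent_part A m =
    {\<phi>. hom_part m \<phi> = \<phi> \<and> homological A \<phi> = 0 \<and> (m < 2 \<longrightarrow> \<phi> = 0)}"

lemma series_eq_iff_hom_part: "F = G \<longleftrightarrow> (\<forall>m. hom_part m F = hom_part m G)"
proof
  assume hom: "\<forall>m. hom_part m F = hom_part m G"
  show "F = G"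
  proof (rule series_eqI)
    fix a and \<alpha> :: "'a \<Rightarrow> nat"
    have "mcoeff (hom_part (mdeg \<alpha>) F $ a) \<alpha> = mcoeff (hom_part (mdeg \<alpha>) G $ a) \<alpha>"
      using hom by simp
    then show "mcoeff (F $ a) \<alpha> = mcoeff (G $ a) \<alpha>"
      by simp
  qed
qed simp

lemma hom_part_0 [simp]: "hom_part m 0 = 0"
  by (rule series_eqI) simp

lemma formal_diff0_iff_hom_part:
  "k \<in> formal_diff0 \<longleftrightarrow> (\<forall>m<2. hom_part m (coords k) = 0)"
  unfolding formal_diff0_iff_low_order
  by (auto simp: vec_eq_iff coords_def hom_part_def zero_mfps_def Abs_mfps_inject fun_eq_iff
      split: if_splits)

text \<open>
  As \<^term>\<open>homological A\<close> preserves the degree, commuting with \<open>A\<close> is a separate condition on each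
  homogeneous part. The centralizer is therefore the full product of the spaces
  \<^term>\<open>cent_part A m\<close>.
\<close>

lemma Cent_iff_hom_part: "k \<in> Cent A \<longleftrightarrow> (\<forall>m. hom_part m (coords k) \<in> cent_part A m)"
proof -
  have "fcomp k (linear_series A) = fcomp (linear_series A) k \<longleftrightarrow> homological A k = 0"
    if "k \<in> formal_diff0"
    using that by (auto simp: homological_def formal_diff0_iff fcomp_linear_series_left)
  moreover have "homological A (coords k) = homological A k"
    by (simp add: coords_def series.linear_diff[OF linear_homological] homological_identity)
  moreover have "homological A (coords k) = 0 \<longleftrightarrow> (\<forall>m. homological A (hom_part m (coords k)) = 0)"
    by (subst series_eq_iff_hom_part) (simp add: hom_part_homological)
  ultimately show ?thesis
    unfolding Cent_def cent_part_def by (auto simp: hom_part_hom_part formal_diff0_iff_hom_part)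
qed

lemma subspace_cent_part: "series.vs1.subspace (cent_part A m)"
  using linear_homological[of A] unfolding cent_part_def
  by (intro series.vs1.subspaceI)
    (auto simp: hom_part_add hom_part_cscale series.linear_add series.linear_scale homological_0)

lemma cent_part_disjoint:
  assumes "\<phi> \<in> cent_part A i" "\<phi> \<in> cent_part A j" "i \<noteq> j"
  shows "\<phi> = 0"
  using assms hom_part_hom_part[of i j \<phi>] by (auto simp: cent_part_def)

lemma cent_part_basis:
  obtains C where "finite C" "series.vs1.independent C" "series.vs1.span C = cent_part A m"
proof -
  obtain C where C: "C \<subseteq> cent_part A m" "series.vs1.independent C" "cent_part A m \<subseteq> series.vs1.span C"
    by (rule series.vs1.maximal_independent_subset)
  let ?B = "(\<lambda>x. basis_series (fst x) (snd x)) ` (UNIV \<times> {\<alpha> :: 'a \<Rightarrow> nat. mdeg \<alpha> = m})"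
  have "hom_part m \<phi> \<in> series.vs1.span ?B" for \<phi>
    unfolding hom_part_expansion
    by (intro series.vs1.span_sum series.vs1.span_scale series.vs1.span_base imageI)
  then have "\<phi> \<in> series.vs1.span ?B" if "\<phi> \<in> C" for \<phi>
    using that C(1) by (metis (mono_tags, lifting) cent_part_def mem_Collect_eq subsetD)
  then have "C \<subseteq> series.vs1.span ?B" ..
  then have "finite C"
    using series.vs1.independent_span_bound[of ?B C] C(2) by (simp add: finite_mdeg_eq)
  moreover have "series.vs1.span C = cent_part A m"
    using C series.vs1.span_minimal[OF C(1) subspace_cent_part] by blast
  ultimately show ?thesis
    using that C(2) by blast
qed

lemma cent_part_in_Cent:
  assumes "\<phi> \<in> cent_part A j"
  shows "linear_series (mat 1) + \<phi> \<in> Cent A"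
  unfolding Cent_iff_hom_part coords_add_identity
proof
  fix m
  show "hom_part m \<phi> \<in> cent_part A m"
    using assms hom_part_hom_part[of m j \<phi>] by (cases "m = j") (auto simp: cent_part_def homological_0)
qed

text \<open>
  The \<open>m\<close>-jets of the centralizer are the direct sum of the spaces \<^term>\<open>cent_part A j\<close> with
  \<open>j \<le> m\<close>, so that a basis is obtained by uniting bases of these.
\<close>

lemma cent_dim_eq_sum_card:
  assumes C: "\<And>j. finite (C j)" "\<And>j. series.vs1.independent (C j)"
    "\<And>j. series.vs1.span (C j) = cent_part A j"
  shows "cent_dim A m = (\<Sum>j\<le>m. card (C j))"
proof -
  let ?B = "\<Union>j\<le>m. C j"
  have C_part: "x \<in> cent_part A j" if "x \<in> C j" for x j
    using that C(3) series.vs1.span_base by blast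
  have hom_C: "hom_part i x = (if i = j then x else 0)" if "x \<in> C j" for x i j
    using C_part[OF that] hom_part_hom_part[of i j x] by (auto simp: cent_part_def)
  have disjoint: "C i \<inter> C j = {}" if "i \<noteq> j" for i j
    using cent_part_disjoint[OF C_part C_part that] series.vs1.dependent_zero[of "C i"] C(2)[of i]
    by blast
  have "finite ?B"
    using C(1) by auto
  have "series.vs1.independent ?B"
  proof (rule series.vs1.independent_if_scalars_zero[OF \<open>finite ?B\<close>])
    fix c x
    assume sum0: "(\<Sum>x\<in>?B. cscale (c x) x) = 0" and "x \<in> ?B"
    then obtain j where j: "j \<le> m" "x \<in> C j"
      by auto
    have "hom_part j (\<Sum>x\<in>?B. cscale (c x) x) = (\<Sum>x\<in>?B. cscale (c x) (hom_part j x))"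
      by (rule series_eqI) (simp add: sum_component)
    also have "\<dots> = (\<Sum>x\<in>C j. cscale (c x) x)"
      using \<open>finite ?B\<close> j(1) by (intro sum.mono_neutral_cong_right) (auto simp: hom_C split: if_splits)
    finally have "(\<Sum>x\<in>C j. cscale (c x) x) = 0"
      by (simp add: sum0)
    then show "c x = 0"
      using series.vs1.independentD[OF C(2)[of j] C(1)[of j] order_refl _ j(2)] by blast
  qed
  moreover have "series.vs1.span ?B = series.vs1.span ((\<lambda>k. jet m (coords k)) ` Cent A)"
  proof (rule series.vs1.span_eq[THEN iffD2], intro conjI subsetI)
    fix x
    assume "x \<in> ?B"
    then obtain j where j: "j \<le> m" "x \<in> C j"
      by auto
    have "jet m x = x"
      unfolding jet_eq_sum_hom_part using j by (simp add: hom_C)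
    then have "x = jet m (coords (linear_series (mat 1) + x))"
      by simp
    then show "x \<in> series.vs1.span ((\<lambda>k. jet m (coords k)) ` Cent A)"
      using cent_part_in_Cent[OF C_part[OF j(2)]] by (intro series.vs1.span_base) (rule image_eqI)
  next
    fix x
    assume "x \<in> (\<lambda>k. jet m (coords k)) ` Cent A"
    then obtain k where k: "k \<in> Cent A" "x = jet m (coords k)"
      by auto
    have "hom_part j (coords k) \<in> series.vs1.span ?B" if "j \<le> m" for j
      using k(1) that C(3)[of j] series.vs1.span_mono[of "C j" ?B] by (auto simp: Cent_iff_hom_part)
    then show "x \<in> series.vs1.span ?B"
      unfolding k(2) jet_eq_sum_hom_part by (intro series.vs1.span_sum) auto
  qed
  ultimately have "cent_dim A m = card ?B"
    unfolding cent_dim_def by (intro series.vs1.dim_eq_card) auto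
  also have "\<dots> = (\<Sum>j\<le>m. card (C j))"
    using C(1) disjoint by (intro card_UN_disjoint) auto
  finally show ?thesis .
qed

definition block_sum :: "(nat \<Rightarrow> nat) \<Rightarrow> (nat \<Rightarrow> 'n::finite mfps ^ 'n) \<Rightarrow> nat \<Rightarrow> (nat \<Rightarrow> complex) \<Rightarrow> 'n mfps ^ 'n"
  where "block_sum off b m s = (\<Sum>l\<in>{off m..<off (Suc m)}. cscale (s l) (b l))"

text \<open>
  Concatenating bases of the spaces \<^term>\<open>cent_part A m\<close>, in the order of their degrees, numbers
  the coordinates so that degree \<open>m\<close> uses those from \<open>off m\<close> up to \<open>off (Suc m)\<close>.
\<close>

lemma cent_coordinates:
  fixes A :: "complex ^ 'n ^ 'n::finite"
  obtains off b where "off 0 = 0" "mono off" "\<And>m. cent_dim A m = off (Suc m)"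
    "\<And>m s. block_sum off b m s \<in> cent_part A m"
    "\<And>m s. block_sum off b m s = 0 \<Longrightarrow> \<forall>l\<in>{off m..<off (Suc m)}. s l = 0"
    "\<And>m \<phi>. \<phi> \<in> cent_part A m \<Longrightarrow> \<exists>s. block_sum off b m s = \<phi>"
proof -
  have "\<forall>m. \<exists>C. finite C \<and> series.vs1.independent C \<and> series.vs1.span C = cent_part A m"
    using cent_part_basis by metis
  then obtain C where C: "\<And>m. finite (C m)" "\<And>m. series.vs1.independent (C m)"
    "\<And>m. series.vs1.span (C m) = cent_part A m"
    by metis
  define off where "off m = (\<Sum>j<m. card (C j))" for m
  have off_Suc: "off (Suc m) = off m + card (C m)" for m
    by (simp add: off_def)
  have "\<exists>e. bij_betw e {off m..<off (Suc m)} (C m)" for m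
    using C(1) by (intro finite_same_card_bij) (auto simp: off_Suc)
  then obtain e where e: "\<And>m. bij_betw (e m) {off m..<off (Suc m)} (C m)"
    by metis
  have "mono off"
    by (rule incseq_SucI) (simp add: off_Suc)
  have block_unique: "i = m" if "off i \<le> l" "l < off (Suc i)" "off m \<le> l" "l < off (Suc m)" for i m l
  proof (rule antisym)
    show "i \<le> m"
      using that monoD[OF \<open>mono off\<close>, of "Suc m" i] by (cases "i \<le> m") auto
    show "m \<le> i"
      using that monoD[OF \<open>mono off\<close>, of "Suc i" m] by (cases "m \<le> i") auto
  qed
  define b where "b l = e (THE m. off m \<le> l \<and> l < off (Suc m)) l" for l
  have b: "b l = e m l" if "l \<in> {off m..<off (Suc m)}" for l m
  proof -
    have "(THE m. off m \<le> l \<and> l < off (Suc m)) = m"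
      using that block_unique by (intro the_equality) auto
    then show ?thesis
      by (simp add: b_def)
  qed
  define e' where "e' m = the_inv_into {off m..<off (Suc m)} (e m)" for m
  have e': "e' m (e m l) = l" if "l \<in> {off m..<off (Suc m)}" for m l
    using that e[of m] by (simp add: e'_def bij_betw_def the_inv_into_f_f)
  have block_sum: "block_sum off b m s = (\<Sum>x\<in>C m. cscale (s (e' m x)) x)" for m s
    unfolding block_sum_def sum.reindex_bij_betw[OF e, symmetric]
    by (rule sum.cong) (auto simp: b e')
  show ?thesis
  proof (rule that)
    show "off 0 = 0"
      by (simp add: off_def)
    show "mono off"
      by fact
    show "cent_dim A m = off (Suc m)" for m
      unfolding cent_dim_eq_sum_card[OF C] off_def by (rule sum.cong) auto
    show "block_sum off b m s \<in> cent_part A m" for m s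
      unfolding block_sum C(3)[symmetric]
      by (intro series.vs1.span_sum series.vs1.span_scale series.vs1.span_base)
    show "\<forall>l\<in>{off m..<off (Suc m)}. s l = 0" if "block_sum off b m s = 0" for m s
    proof
      fix l
      assume l: "l \<in> {off m..<off (Suc m)}"
      then have "e m l \<in> C m"
        using bij_betwE[OF e[of m]] by blast
      from series.vs1.independentD[OF C(2) C(1) order_refl that[unfolded block_sum] this]
      show "s l = 0"
        using l by (simp add: e')
    qed
    show "\<exists>s. block_sum off b m s = \<phi>" if "\<phi> \<in> cent_part A m" for m \<phi>
    proof -
      have "\<phi> \<in> range (\<lambda>u. \<Sum>x\<in>C m. cscale (u x) x)"
        using that unfolding C(3)[symmetric] series.vs1.span_finite[OF C(1)] .
      then obtain u where u: "\<phi> = (\<Sum>x\<in>C m. cscale (u x) x)"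
        by blast
      have "u (e m (e' m x)) = u x" if "x \<in> C m" for x
        using that e[of m] by (auto simp: e'_def bij_betw_def f_the_inv_into_f)
      then have "block_sum off b m (\<lambda>l. u (e m l)) = \<phi>"
        unfolding block_sum u by (intro sum.cong) auto
      then show ?thesis
        by blast
    qed
  qed
qed

lemma cent_dim_lim_eq_SUP:
  assumes "mono (cent_dim A)"
  shows "cent_dim_lim A = (SUP m. enat (cent_dim A m))"
  unfolding cent_dim_lim_def
  using assms by (intro limI LIMSEQ_SUP) (auto simp: incseq_def mono_def)

text \<open>
  The sum \<open>\<Sum>l. s l b\<^sub>l\<close> over all basis elements may be infinite, but each coefficient only
  involves one block of it, namely that of its own degree. Hence \<open>\<psi>\<close> is defined on all
  sequences, each of its coefficients is affine in finitely many coordinates, and its \<open>m\<close>-jet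
  reads exactly the blocks up to degree \<open>m\<close>, that is, the first \<^term>\<open>cent_dim A m\<close>
  coordinates.
\<close>

lemma cent_parametrization_exists:
  fixes A :: "complex ^ 'n ^ 'n::finite"
  obtains \<psi> where "cent_parametrization A \<psi>"
    "\<And>a \<alpha>. \<exists>c0 c L. \<forall>s. mcoeff (\<psi> s $ a) \<alpha> = c0 + (\<Sum>l\<in>L. c l * s l)"
proof -
  obtain off b where off: "off 0 = 0" "mono off" "\<And>m. cent_dim A m = off (Suc m)"
    and in_part: "\<And>m s. block_sum off b m s \<in> cent_part A m"
    and indep: "\<And>m s. block_sum off b m s = 0 \<Longrightarrow> \<forall>l\<in>{off m..<off (Suc m)}. s l = 0"
    and spanning: "\<And>m \<phi>. \<phi> \<in> cent_part A m \<Longrightarrow> \<exists>s. block_sum off b m s = \<phi>"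
    using cent_coordinates[of A] by blast
  let ?\<delta> = "cent_dim_lim A"
  have dim_mono: "mono (cent_dim A)"
    using off(2,3) by (simp add: mono_def)
  have dim_le: "enat (off (Suc m)) \<le> ?\<delta>" for m
    unfolding cent_dim_lim_eq_SUP[OF dim_mono] off(3)[symmetric] by (rule SUP_upper) simp
  have below: "\<exists>m. l < off (Suc m)" if "enat l < ?\<delta>" for l
    using that unfolding cent_dim_lim_eq_SUP[OF dim_mono] less_SUP_iff off(3) by simp
  have block: "\<exists>j\<le>m. l \<in> {off j..<off (Suc j)}" if "l < off (Suc m)" for l m
    using that
  proof (induction m)
    case (Suc m)
    then show ?case
      by (cases "l < off (Suc m)") (auto intro: le_SucI)
  qed (simp add: off(1))
  define \<Psi> :: "(nat \<Rightarrow> complex) \<Rightarrow> 'n mfps ^ 'n"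
    where "\<Psi> s = (\<chi> a. Abs_mfps (\<lambda>\<alpha>. mcoeff (block_sum off b (mdeg \<alpha>) s $ a) \<alpha>))" for s
  define \<psi> where "\<psi> s = linear_series (mat 1) + \<Psi> s" for s
  have mcoeff_block_sum: "mcoeff (block_sum off b m s $ a) \<alpha> =
      (\<Sum>l\<in>{off m..<off (Suc m)}. s l * mcoeff (b l $ a) \<alpha>)" for m s a \<alpha>
    by (simp add: block_sum_def sum_component)
  have hom_\<Psi>: "hom_part m (\<Psi> s) = block_sum off b m s" for m s
  proof -
    have "hom_part m (\<Psi> s) = hom_part m (block_sum off b m s)"
      by (rule series_eqI) (simp add: \<Psi>_def)
    then show ?thesis
      using in_part[of m s] by (simp add: cent_part_def)
  qed
  have \<psi>_Cent: "\<psi> s \<in> Cent A" for s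
    unfolding Cent_iff_hom_part by (simp add: \<psi>_def hom_\<Psi> in_part)
  have agree: "s l = s' l" if "block_sum off b m s = block_sum off b m s'" "l \<in> {off m..<off (Suc m)}"
    for m s s' l
  proof -
    have "block_sum off b m (\<lambda>l. s l - s' l) = block_sum off b m s - block_sum off b m s'"
      by (rule series_eqI) (simp add: mcoeff_block_sum left_diff_distrib sum_subtractf)
    then show ?thesis
      using indep[of m "\<lambda>l. s l - s' l"] that by simp
  qed
  have block_cong: "block_sum off b m s = block_sum off b m s'"
    if "\<And>l. l \<in> {off m..<off (Suc m)} \<Longrightarrow> s l = s' l" for m s s'
    unfolding block_sum_def using that by (intro sum.cong) auto
  have jet_agree: "s l = s' l" if jet: "jet m (\<psi> s) = jet m (\<psi> s')" and l: "l < off (Suc m)" for s s' l m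
  proof -
    obtain j where j: "j \<le> m" "l \<in> {off j..<off (Suc j)}"
      using block[OF l] by blast
    have "hom_part j (jet m F) = hom_part j F" for F :: "'n mfps ^ 'n"
      using j(1) by (intro series_eqI) simp
    then have "hom_part j (\<psi> s) = hom_part j (\<psi> s')"
      using jet by metis
    then have "hom_part j (\<Psi> s) = hom_part j (\<Psi> s')"
      by (simp add: \<psi>_def hom_part_add)
    then show ?thesis
      using agree[of j s s' l] j(2) by (simp add: hom_\<Psi>)
  qed
  have surj: "\<exists>s\<in>cspace ?\<delta>. k = \<psi> s" if k: "k \<in> Cent A" for k
  proof -
    have "\<forall>m. \<exists>s. block_sum off b m s = hom_part m (coords k)"
      using k spanning by (auto simp: Cent_iff_hom_part)
    then obtain \<sigma> where \<sigma>: "\<And>m. block_sum off b m (\<sigma> m) = hom_part m (coords k)"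
      by metis
    (* The blocks are disjoint, so that sequences realizing the single homogeneous parts can be
       glued; the coordinate l is taken from the degree whose block contains it. *)
    define s where "s l = (if enat l < ?\<delta> then \<sigma> (LEAST m. l < off (Suc m)) l else 0)" for l
    have "block_sum off b m s = block_sum off b m (\<sigma> m)" for m
    proof (rule block_cong)
      fix l
      assume l: "l \<in> {off m..<off (Suc m)}"
      have "(LEAST m. l < off (Suc m)) = m"
      proof (rule Least_equality)
        fix i
        assume "l < off (Suc i)"
        then have "\<not> Suc i \<le> m"
          using l monoD[OF off(2), of "Suc i" m] by auto
        then show "m \<le> i"
          by simp
      qed (use l in simp)
      moreover have "enat l < ?\<delta>"
        using l by (intro less_le_trans[OF _ dim_le[of m]]) simp
      ultimately show "s l = \<sigma> m l"
        by (simp add: s_def)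
    qed
    then have "\<Psi> s = coords k"
      by (subst series_eq_iff_hom_part) (simp add: hom_\<Psi> \<sigma>)
    then have "k = \<psi> s"
      by (simp add: \<psi>_def coords_def)
    moreover have "s \<in> cspace ?\<delta>"
      by (auto simp: cspace_def s_def)
    ultimately show ?thesis
      by blast
  qed
  have truncate: "jet m (\<psi> s) = jet m (\<psi> (\<lambda>l. if l < cent_dim A m then s l else 0))" for m s
  proof -
    have "block_sum off b j s = block_sum off b j (\<lambda>l. if l < cent_dim A m then s l else 0)"
      if "j \<le> m" for j
    proof (rule block_cong)
      fix l
      assume "l \<in> {off j..<off (Suc j)}"
      then have "l < off (Suc m)"
        using that monoD[OF off(2), of "Suc j" "Suc m"] by simp
      then show "s l = (if l < cent_dim A m then s l else 0)"
        by (simp add: off(3))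
    qed
    then show ?thesis
      by (intro series_eqI) (simp add: \<psi>_def \<Psi>_def)
  qed
  have "cent_parametrization A \<psi>"
    unfolding cent_parametrization_def
  proof (intro conjI allI ballI)
    show "bij_betw \<psi> (cspace ?\<delta>) (Cent A)"
    proof (rule bij_betw_imageI)
      show "inj_on \<psi> (cspace ?\<delta>)"
      proof (rule inj_onI, rule ext)
        fix s s' l
        assume s: "s \<in> cspace ?\<delta>" "s' \<in> cspace ?\<delta>" "\<psi> s = \<psi> s'"
        show "s l = s' l"
        proof (cases "enat l < ?\<delta>")
          case True
          then obtain m where "l < off (Suc m)"
            using below by blast
          then show ?thesis
            using jet_agree[of m s s' l] s(3) by simp
        next
          case False
          then show ?thesis
            using s(1,2) by (simp add: cspace_def)
        qed
      qed
      show "\<psi> ` cspace ?\<delta> = Cent A"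
        using \<psi>_Cent surj by blast
    qed
    show "coords (\<psi> (\<lambda>l. x * s l + y * s' l)) = cscale x (coords (\<psi> s)) + cscale y (coords (\<psi> s'))"
      for x y s s'
      by (rule series_eqI)
        (simp add: \<psi>_def \<Psi>_def mcoeff_block_sum distrib_right sum.distrib sum_distrib_left mult.assoc)
    show "jet m (\<psi> s) = jet m (\<psi> (\<lambda>l. if l < cent_dim A m then s l else 0))" for m s
      by (rule truncate)
    show "bij_betw (\<lambda>s. jet m (\<psi> s)) (cspace (enat (cent_dim A m))) (jet m ` Cent A)" for m
    proof (rule bij_betw_imageI)
      show "inj_on (\<lambda>s. jet m (\<psi> s)) (cspace (enat (cent_dim A m)))"
      proof (rule inj_onI, rule ext)
        fix s s' l
        assume s: "s \<in> cspace (enat (cent_dim A m))" "s' \<in> cspace (enat (cent_dim A m))"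
          "jet m (\<psi> s) = jet m (\<psi> s')"
        show "s l = s' l"
          using jet_agree[OF s(3), of l] s(1,2) by (cases "l < off (Suc m)") (auto simp: cspace_def off(3))
      qed
      show "(\<lambda>s. jet m (\<psi> s)) ` cspace (enat (cent_dim A m)) = jet m ` Cent A"
      proof (intro equalityI subsetI)
        fix x
        assume "x \<in> jet m ` Cent A"
        then obtain s where "x = jet m (\<psi> s)"
          using surj by blast
        then have "x = jet m (\<psi> (\<lambda>l. if l < cent_dim A m then s l else 0))"
          using truncate by simp
        moreover have "(\<lambda>l. if l < cent_dim A m then s l else 0) \<in> cspace (enat (cent_dim A m))"
          by (simp add: cspace_def)
        ultimately show "x \<in> (\<lambda>s. jet m (\<psi> s)) ` cspace (enat (cent_dim A m))"
          by (rule image_eqI)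
      qed (use \<psi>_Cent in blast)
    qed
  qed
  moreover have "\<exists>c0 c L. \<forall>s. mcoeff (\<psi> s $ a) \<alpha> = c0 + (\<Sum>l\<in>L. c l * s l)" for a \<alpha>
    by (rule exI[of _ "mcoeff (linear_series (mat 1) $ a) \<alpha>"],
        rule exI[of _ "\<lambda>l. mcoeff (b l $ a) \<alpha>"],
        rule exI[of _ "{off (mdeg \<alpha>)..<off (Suc (mdeg \<alpha>))}"])
      (simp add: \<psi>_def \<Psi>_def mcoeff_block_sum mult.commute)
  ultimately show ?thesis
    by (rule that)
qed


section \<open>Families of linearizations\<close>

lemma Cent_fcomp_linearization:
  assumes A: "invertible A" and f: "f \<in> carrier formal_diff"
    and k: "k \<in> Cent A" and h: "h \<in> formal_linearizations A f"
  shows "fcomp k h \<in> formal_linearizations A f"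
proof -
  have h': "h \<in> formal_diff0" "fcomp h f = mat_act A h"
    using h formal_linearizations_iff[OF f A] by auto
  then have nc: "no_const h" "no_const f" "no_const k"
    using f k by (auto simp: formal_diff0_iff carrier_formal_diff Cent_def)
  have kA: "k \<in> formal_diff0" "fcomp k (linear_series A) = mat_act A k"
    using k nc by (auto simp: Cent_def fcomp_linear_series_left)
  have "fcomp (fcomp k h) f = fcomp k (fcomp (linear_series A) h)"
    using nc by (simp add: fcomp_assoc h' fcomp_linear_series_left)
  also have "\<dots> = mat_act A (fcomp k h)"
    using nc by (simp add: kA mat_act_fcomp no_const_linear_series flip: fcomp_assoc)
  finally show ?thesis
    using h' kA(1) by (simp add: formal_linearizations_iff[OF f A] formal_diff0_fcomp)
qed

theorem theorem2:
  fixes A :: "complex ^ 'n ^ 'n::finite"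
    and d0 :: nat
    and F :: "('k::finite \<Rightarrow> nat) \<Rightarrow> 'n mfps ^ 'n"
    and f :: "complex ^ 'k \<Rightarrow> 'n mfps ^ 'n"
  assumes "invertible A"
    and "\<And>i a \<alpha>. mdeg i \<le> d0 \<Longrightarrow> mdeg \<alpha> < 2 \<Longrightarrow> mcoeff (F i $ a) \<alpha> = 0"
    and "\<And>t. f t = linear_series A + (\<Sum>i | mdeg i \<le> d0. cscale (monom_eval t i) (F i))"
    and "\<And>t. f t \<in> linearizable_set A"
  shows "\<exists>(\<psi> :: (nat \<Rightarrow> complex) \<Rightarrow> 'n mfps ^ 'n)
           (h0 :: complex ^ 'k \<Rightarrow> 'n mfps ^ 'n)
           (h :: complex ^ 'k \<Rightarrow> (nat \<Rightarrow> complex) \<Rightarrow> 'n mfps ^ 'n).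
           cent_parametrization A \<psi> \<and>
           (\<forall>t. h0 t \<in> formal_linearizations A (f t)) \<and>
           (\<forall>t. \<forall>s\<in>cspace (cent_dim_lim A).
              h t s = univ_linearization \<psi> (h0 t) s \<and>
              h t s \<in> formal_linearizations A (f t)) \<and>
           poly_family (cspace (cent_dim_lim A)) h \<and>
           (\<forall>m a \<alpha>. mdeg \<alpha> = m \<longrightarrow>
              poly_fun (cspace (cent_dim_lim A)) (d0 * m) 1 (\<lambda>t s. mcoeff (h t s $ a) \<alpha>))"
proof -
  let ?S = "cspace (cent_dim_lim A)"
  have f_coeff: "mcoeff (f t $ j) \<alpha> = mcoeff (linear_series A $ j) \<alpha> +
      (\<Sum>i | mdeg i \<le> d0. mcoeff (F i $ j) \<alpha> * monom_eval t i)" for t j \<alpha>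
    by (simp add: assms(3) sum_component mult.commute)
  have f_low: "mcoeff (f t $ j) \<alpha> = mcoeff (linear_series A $ j) \<alpha>" if "mdeg \<alpha> < 2" for t j \<alpha>
    using assms(2) that by (simp add: f_coeff)
  have f_no_const: "no_const (f t)" for t
    by (simp add: no_const_def f_low mcoeff_linear_series_eq_0)
  have f_linear_part: "linear_part (f t) = A" for t
    by (simp add: linear_part_def vec_eq_iff f_low mcoeff_linear_series)
  have f_carrier: "f t \<in> carrier formal_diff" for t
    using assms(1) by (simp add: carrier_formal_diff f_no_const f_linear_part)
  (* The linear part of f t does not depend on t, and in order m \<ge> 2 the degree d0 is at most
     d0 (m - 1). *)
  have f_poly: "poly_fun ?S (d0 * (mdeg \<alpha> - 1)) 0 (\<lambda>t s. mcoeff (f t $ j) \<alpha>)" for j \<alpha>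
  proof (cases "mdeg \<alpha> < 2")
    case True
    then show ?thesis
      by (simp add: f_low poly_fun_const)
  next
    case False
    have "poly_fun ?S d0 0 (\<lambda>t s. mcoeff (F i $ j) \<alpha> * monom_eval t i)" if "mdeg i \<le> d0" for i
      using poly_fun_monomial[of i d0 "{#}" 0 ?S "mcoeff (F i $ j) \<alpha>"] that by simp
    then have "poly_fun ?S d0 0 (\<lambda>t s. mcoeff (f t $ j) \<alpha>)"
      unfolding f_coeff by (intro poly_fun_add poly_fun_const poly_fun_sum) simp
    moreover have "d0 \<le> d0 * (mdeg \<alpha> - 1)"
      using False by (cases "mdeg \<alpha> - 1") auto
    ultimately show ?thesis
      by (rule poly_fun_mono) simp
  qed
  obtain g where g: "graded_right_inverse A g"
    by (rule graded_right_inverse_exists)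
  define h0 where "h0 t = linearization_limit g A (f t)" for t
  have h0: "h0 t \<in> formal_linearizations A (f t)" for t
  proof -
    obtain h where "h \<in> formal_linearizations A (f t)"
      using linearizable_set_linearization[OF assms(4,1)] by blast
    then show ?thesis
      unfolding h0_def
      by (intro linearization_limit_in_formal_linearizations[OF g assms(1) f_carrier f_linear_part])
  qed
  have "poly_fun ?S (d0 * mdeg \<alpha>) 0 (\<lambda>t s. mcoeff (h0 t $ a) \<alpha>)" for a \<alpha>
    unfolding h0_def by (rule poly_fun_linearization_limit[OF g f_no_const f_poly])
  then have h0_pow: "poly_fun ?S (d0 * mdeg \<alpha>) 0 (\<lambda>t s. mcoeff (mpow (h0 t) \<beta>) \<alpha>)" for \<alpha> \<beta>
    using poly_fun_mpow[of 0 h0 ?S d0 \<alpha> \<beta>] by simp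
  obtain \<psi> where \<psi>: "cent_parametrization A \<psi>"
    and \<psi>_affine: "\<And>a \<alpha>. \<exists>c0 c L. \<forall>s. mcoeff (\<psi> s $ a) \<alpha> = c0 + (\<Sum>l\<in>L. c l * s l)"
    using cent_parametrization_exists[of A] by blast
  have \<psi>_Cent: "\<psi> s \<in> Cent A" if "s \<in> ?S" for s
    using \<psi> that by (auto simp: cent_parametrization_def bij_betw_def)
  have \<psi>_poly: "poly_fun ?S 0 1 (\<lambda>(t :: complex ^ 'k) s. mcoeff (\<psi> s $ a) \<alpha>)" for a \<alpha>
  proof -
    obtain c0 c L where "\<And>s. mcoeff (\<psi> s $ a) \<alpha> = c0 + (\<Sum>l\<in>L. c l * s l)"
      using \<psi>_affine[of a \<alpha>] by blast
    moreover have "poly_fun ?S 0 1 (\<lambda>(t :: complex ^ 'k) s. c0 + (\<Sum>l\<in>L. c l * s l))"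
      by (intro poly_fun_add poly_fun_const poly_fun_sum poly_fun_cmult poly_fun_coordinate)
    ultimately show ?thesis
      by simp
  qed
  define h where "h t s = univ_linearization \<psi> (h0 t) s" for t s
  have h_lin: "h t s \<in> formal_linearizations A (f t)" if "s \<in> ?S" for t s
    using Cent_fcomp_linearization[OF assms(1) f_carrier \<psi>_Cent[OF that] h0]
    by (simp add: h_def univ_linearization_def)
  have h_poly: "poly_fun ?S (d0 * mdeg \<alpha>) 1 (\<lambda>t s. mcoeff (h t s $ a) \<alpha>)" for a \<alpha>
    unfolding h_def univ_linearization_def mult_formal_diff mcoeff_fcomp
  proof (rule poly_fun_sum)
    fix \<beta>
    show "poly_fun ?S (d0 * mdeg \<alpha>) 1 (\<lambda>t s. mcoeff (\<psi> s $ a) \<beta> * mcoeff (mpow (h0 t) \<beta>) \<alpha>)"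
      using poly_fun_mult[OF \<psi>_poly[of a \<beta>] h0_pow[of \<alpha> \<beta>]] by simp
  qed
  show ?thesis
  proof (intro exI conjI allI ballI impI)
    show "cent_parametrization A \<psi>"
      by (rule \<psi>)
    show "h0 t \<in> formal_linearizations A (f t)" for t
      by (rule h0)
    show "h t s = univ_linearization \<psi> (h0 t) s" for t s
      by (rule h_def)
    show "h t s \<in> formal_linearizations A (f t)" if "s \<in> ?S" for t s
      using that by (rule h_lin)
    show "poly_family ?S h"
      unfolding poly_family_def using h_poly by blast
    show "poly_fun ?S (d0 * m) 1 (\<lambda>t s. mcoeff (h t s $ a) \<alpha>)" if "mdeg \<alpha> = m" for m a \<alpha>
      using h_poly that by blast
  qed
qed

end
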